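(* Let $G=(V,E)$ be a finite simple triangle-free graph, and let $\mathbf{M}=(J,\mathcal{B},\eta)$ be a Markov space such that every complete bipartite subgraph $K_{a,b}$ of $G$ is well-measured in $\mathbf{M}$. Then $G$ is well-measured in $\mathbf{M}$.
   Context: A Markov space $(J,\mathcal{B},\eta)$ is a standard Borel space $(J,\mathcal{B})$ with a probability measure $\eta$ on $\mathcal{B}\times\mathcal{B}$ that is symmetric ($\eta(A\times B)=\eta(B\times A)$). Its marginal is $\pi(A)=\eta(A\times J)$. For a finite set $S$, $\mathcal{B}^S$ denotes the product sigma-algebra on $J^S$. Let $G=(V,E)$ be a finite simple graph, and $(\mu_S:S\subseteq V)$ a family of sigma-finite measures, $\mu_S$ on $(J^S,\mathcal{B}^S)$. - The family is decreasing if for all $S\subseteq T\subseteq V$ the marginal of $\mu_T$ on $J^S$ is absolutely continuous with respect to $\mu_S$. In this case, there is a measurable family $(\nu_{S,T,x}:x\in J^S)$ of measures on $\mathcal{B}^{T\setminus S}$ (unique up to changes for $x$ in a $\mu_S$-null set) such that $\mu_T(A\times B)=\int_A \nu_{S,T,x}(B)\,d\mu_S(x)$ for $A\in\mathcal{B}^S$, $B\in\mathcal{B}^{T\setminus S}$. - The family is Markovian (with respect to $G$) if it is decreasing, and for any $U,W\subseteq V$ with $S=U\cap W$ such that no edge of $G$ connects $U\setminus S$ and $W\setminus S$, we have $\nu_{S,U\cup W,x}=\nu_{S,U,x}\times\nu_{S,W,x}$ for $\mu_S$-almost all $x\in J^S$. - The family is normalized if $\mu_S=\pi$ whenever $|S|=1$,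 $\mu_S=\eta$ whenever $S=\{i,j\}$ with $ij\in E$, and $\mu_\emptyset$ is the unit mass on the one-point space $J^\emptyset$. $G$ is well-measured in the Markov space if there is a family $(\mu_S:S\subseteq V)$ that is normalized, decreasing and Markovian with respect to $G$. $K_{a,b}$ ($a,b\ge 1$) is the complete bipartite graph with color classes of sizes $a$ and $b$; stars $K_{1,b}$ are included. *)

theory Defs
  imports "HOL-Probability.Probability" "Graph_Theory.Kuratowski"
begin

text \<open>A measurable space is a value of type \<open>'a measure\<close> of which only \<open>space\<close> and
  \<open>sets\<close> are used.\<close>

definition standard_borel :: "'a measure \<Rightarrow> bool" where
  "standard_borel J \<longleftrightarrow>
     (\<exists>X. completely_metrizable_space X \<and> second_countable X \<and> topspace X = space J \<and>
          sets J = sigma_sets (space J) {U. openin X U})"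

definition markov_space :: "'a measure \<Rightarrow> ('a \<times> 'a) measure \<Rightarrow> bool" where
  "markov_space J \<eta> \<longleftrightarrow>
     standard_borel J \<and> prob_space \<eta> \<and> sets \<eta> = sets (J \<Otimes>\<^sub>M J) \<and>
     (\<forall>A\<in>sets J. \<forall>B\<in>sets J. emeasure \<eta> (A \<times> B) = emeasure \<eta> (B \<times> A))"

definition marginal :: "'a measure \<Rightarrow> ('a \<times> 'a) measure \<Rightarrow> 'a measure" where
  "marginal J \<eta> = distr \<eta> J fst"

abbreviation powM :: "'a measure \<Rightarrow> 'v set \<Rightarrow> ('v \<Rightarrow> 'a) measure" where
  "powM J S \<equiv> PiM S (\<lambda>_. J)"

definition measure_family ::
    "'a measure \<Rightarrow> 'v set \<Rightarrow> ('v set \<Rightarrow> ('v \<Rightarrow> 'a) measure) \<Rightarrow> bool" where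
  "measure_family J V \<mu> \<longleftrightarrow>
     (\<forall>S\<subseteq>V. sets (\<mu> S) = sets (powM J S) \<and> sigma_finite_measure (\<mu> S))"

definition decreasing ::
    "'a measure \<Rightarrow> 'v set \<Rightarrow> ('v set \<Rightarrow> ('v \<Rightarrow> 'a) measure) \<Rightarrow> bool" where
  "decreasing J V \<mu> \<longleftrightarrow>
     (\<forall>T\<subseteq>V. \<forall>S\<subseteq>T.
        absolutely_continuous (\<mu> S) (distr (\<mu> T) (powM J S) (\<lambda>x. restrict x S)))"

text \<open>\<open>slice J S T C x\<close> is the set of all \<open>y \<in> J\<^sup>T\<^sup>-\<^sup>S\<close> such that the point \<open>(x, y)\<close> of
  \<open>J\<^sup>T\<close> lies in \<open>C\<close>.\<close>

definition slice ::
    "'a measure \<Rightarrow> 'v set \<Rightarrow> 'v set \<Rightarrow> ('v \<Rightarrow> 'a) set \<Rightarrow> ('v \<Rightarrow> 'a) \<Rightarrow> ('v \<Rightarrow> 'a) set" where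
  "slice J S T C x = {y \<in> space (powM J (T - S)). merge S (T - S) (x, y) \<in> C}"

text \<open>\<open>\<nu>\<close> disintegrates \<open>\<mu> T\<close> over \<open>\<mu> S\<close>. For \<open>C = A \<times> B\<close> the two conditions say that
  \<open>x \<mapsto> \<nu> x B\<close> is measurable and that \<open>\<mu> T (A \<times> B)\<close> is the integral of \<open>\<nu> x B\<close> over
  \<open>x \<in> A\<close> with respect to \<open>\<mu> S\<close> (lemma \<open>disintegration_rectangle\<close> below). They are required for
  every measurable \<open>C\<close>, because \<open>\<mu> T\<close> is only sigma-finite: all rectangles of positive measure
  can then have infinite measure, and their measures do not determine \<open>\<mu> T\<close>, let alone \<open>\<nu>\<close>.
  In the form below \<open>\<nu> x\<close> is sigma-finite for almost all \<open>x\<close>, and \<open>\<nu>\<close> is unique up to a null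
  set of \<open>\<mu> S\<close>.\<close>

definition disintegration ::
    "'a measure \<Rightarrow> ('v set \<Rightarrow> ('v \<Rightarrow> 'a) measure) \<Rightarrow> 'v set \<Rightarrow> 'v set \<Rightarrow>
     (('v \<Rightarrow> 'a) \<Rightarrow> ('v \<Rightarrow> 'a) measure) \<Rightarrow> bool" where
  "disintegration J \<mu> S T \<nu> \<longleftrightarrow>
     (\<forall>x\<in>space (powM J S). sets (\<nu> x) = sets (powM J (T - S))) \<and>
     (\<forall>C\<in>sets (powM J T).
        (\<lambda>x. emeasure (\<nu> x) (slice J S T C x)) \<in> borel_measurable (powM J S) \<and>
        emeasure (\<mu> T) C = (\<integral>\<^sup>+ x. emeasure (\<nu> x) (slice J S T C x) \<partial>\<mu> S))"

lemma disintegration_rectangle: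
  assumes d: "disintegration J \<mu> S T \<nu>" and "S \<subseteq> T"
    and m: "sets (\<mu> S) = sets (powM J S)"
    and A: "A \<in> sets (powM J S)" and B: "B \<in> sets (powM J (T - S))"
  shows "(\<lambda>x. emeasure (\<nu> x) B) \<in> borel_measurable (powM J S)"
    and "emeasure (\<mu> T) {z \<in> space (powM J T). restrict z S \<in> A \<and> restrict z (T - S) \<in> B}
           = (\<integral>\<^sup>+ x\<in>A. emeasure (\<nu> x) B \<partial>\<mu> S)"
proof -
  have T: "S \<union> (T - S) = T" using assms(2) by auto
  define R where
    "R A = {z \<in> space (powM J T). restrict z S \<in> A \<and> restrict z (T - S) \<in> B}" for A
  have R: "R A \<in> sets (powM J T)" if "A \<in> sets (powM J S)" for A
  proof -
    have S: "(\<lambda>z. restrict z S) \<in> measurable (powM J T) (powM J S)"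
      using assms(2) by (intro measurable_restrict_subset)
    have TS: "(\<lambda>z. restrict z (T - S)) \<in> measurable (powM J T) (powM J (T - S))"
      by (intro measurable_restrict_subset) auto
    have "R A = ((\<lambda>z. restrict z S) -` A \<inter> space (powM J T)) \<inter>
                ((\<lambda>z. restrict z (T - S)) -` B \<inter> space (powM J T))"
      by (auto simp: R_def)
    then show ?thesis
      using measurable_sets[OF S that] measurable_sets[OF TS B] by auto
  qed
  have sl: "slice J S T (R A) x = (if x \<in> A then B else {})"
    if x: "x \<in> space (powM J S)" for A x
  proof -
    have "merge S (T - S) (x, y) \<in> R A \<longleftrightarrow> x \<in> A \<and> y \<in> B"
      if y: "y \<in> space (powM J (T - S))" for y
    proof -
      have "merge S (T - S) (x, y) \<in> space (powM J T)"
        using x y T by (auto simp: space_PiM PiE_def Pi_def extensional_def merge_def)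
      moreover have "restrict (merge S (T - S) (x, y)) S = x"
        using x by (auto simp: space_PiM restrict_def merge_def PiE_def extensional_def)
      moreover have "restrict (merge S (T - S) (x, y)) (T - S) = y"
        using y by (auto simp: space_PiM restrict_def merge_def PiE_def extensional_def)
      ultimately show ?thesis by (simp add: R_def)
    qed
    then show ?thesis
      using sets.sets_into_space[OF B] by (auto simp: slice_def)
  qed
  have "(\<lambda>x. emeasure (\<nu> x) (slice J S T (R (space (powM J S))) x)) \<in> borel_measurable (powM J S)"
    using d R[OF sets.top] by (auto simp: disintegration_def)
  then show "(\<lambda>x. emeasure (\<nu> x) B) \<in> borel_measurable (powM J S)"
    by (subst measurable_cong[where g = "\<lambda>x. emeasure (\<nu> x)
          (slice J S T (R (space (powM J S))) x)"]) (auto simp: sl)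
  have "emeasure (\<mu> T) (R A) = (\<integral>\<^sup>+ x. emeasure (\<nu> x) (slice J S T (R A) x) \<partial>\<mu> S)"
    using d R[OF A] by (auto simp: disintegration_def)
  also have "\<dots> = (\<integral>\<^sup>+ x\<in>A. emeasure (\<nu> x) B \<partial>\<mu> S)"
    using sets_eq_imp_space_eq[OF m] by (intro nn_integral_cong) (auto simp: sl)
  finally show "emeasure (\<mu> T) {z \<in> space (powM J T). restrict z S \<in> A \<and> restrict z (T - S) \<in> B}
           = (\<integral>\<^sup>+ x\<in>A. emeasure (\<nu> x) B \<partial>\<mu> S)"
    by (simp add: R_def)
qed

text \<open>\<open>prodM J P Q M N\<close> is the product of measures \<open>M\<close> on \<open>J\<^sup>P\<close> and \<open>N\<close> on \<open>J\<^sup>Q\<close>, transported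
  to \<open>J\<^sup>P\<^sup>\<union>\<^sup>Q\<close> for disjoint \<open>P\<close> and \<open>Q\<close>.\<close>

definition prodM ::
    "'a measure \<Rightarrow> 'v set \<Rightarrow> 'v set \<Rightarrow> ('v \<Rightarrow> 'a) measure \<Rightarrow> ('v \<Rightarrow> 'a) measure \<Rightarrow>
     ('v \<Rightarrow> 'a) measure" where
  "prodM J P Q M N = distr (M \<Otimes>\<^sub>M N) (powM J (P \<union> Q)) (merge P Q)"

text \<open>The measures \<open>\<mu> S\<close> determine \<open>\<nu> S T\<close> up to a null set, so quantifying \<open>\<nu>\<close>
  existentially or universally makes no difference.\<close>

definition markovian ::
    "'a measure \<Rightarrow> ('v, 'e) pre_digraph \<Rightarrow> ('v set \<Rightarrow> ('v \<Rightarrow> 'a) measure) \<Rightarrow> bool" where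
  "markovian J G \<mu> \<longleftrightarrow>
     decreasing J (verts G) \<mu> \<and>
     (\<exists>\<nu>. (\<forall>T\<subseteq>verts G. \<forall>S\<subseteq>T. disintegration J \<mu> S T (\<nu> S T)) \<and>
          (\<forall>U\<subseteq>verts G. \<forall>W\<subseteq>verts G. \<forall>S. S = U \<inter> W \<longrightarrow>
             (\<forall>u\<in>U - S. \<forall>w\<in>W - S. \<not> u \<rightarrow>\<^bsub>G\<^esub> w) \<longrightarrow>
             (AE x in \<mu> S. \<nu> S (U \<union> W) x = prodM J (U - S) (W - S) (\<nu> S U x) (\<nu> S W x))))"

text \<open>\<open>\<pi>\<close> and \<open>\<eta>\<close> are transported along \<open>J \<cong> J\<^sup>{\<^sup>i\<^sup>}\<close> and \<open>J \<times> J \<cong> J\<^sup>{\<^sup>i\<^sup>,\<^sup>j\<^sup>}\<close>.\<close>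

definition normalized ::
    "'a measure \<Rightarrow> ('a \<times> 'a) measure \<Rightarrow> ('v, 'e) pre_digraph \<Rightarrow>
     ('v set \<Rightarrow> ('v \<Rightarrow> 'a) measure) \<Rightarrow> bool" where
  "normalized J \<eta> G \<mu> \<longleftrightarrow>
     (\<forall>i\<in>verts G. \<mu> {i} = distr (marginal J \<eta>) (powM J {i}) (\<lambda>a. \<lambda>k\<in>{i}. a)) \<and>
     (\<forall>i j. i \<rightarrow>\<^bsub>G\<^esub> j \<longrightarrow>
        \<mu> {i, j} = distr \<eta> (powM J {i, j}) (\<lambda>(a, b). \<lambda>k\<in>{i, j}. if k = i then a else b)) \<and>
     \<mu> {} = return (powM J {}) (\<lambda>_. undefined)"

definition well_measured ::
    "'a measure \<Rightarrow> ('a \<times> 'a) measure \<Rightarrow> ('v, 'e) pre_digraph \<Rightarrow> bool" where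
  "well_measured J \<eta> G \<longleftrightarrow>
     (\<exists>\<mu>. measure_family J (verts G) \<mu> \<and> normalized J \<eta> G \<mu> \<and>
          decreasing J (verts G) \<mu> \<and> markovian J G \<mu>)"

definition triangle_free :: "('v, 'e) pre_digraph \<Rightarrow> bool" where
  "triangle_free G \<longleftrightarrow> \<not> (\<exists>u v w. u \<rightarrow>\<^bsub>G\<^esub> v \<and> v \<rightarrow>\<^bsub>G\<^esub> w \<and> w \<rightarrow>\<^bsub>G\<^esub> u)"

end

theory Submission
  imports Defs
begin

text \<open>
  The family is built by placing the vertices of the graph one after the other. Since the graph has no
  triangles, the neighbours \<open>N\<close> of a vertex \<open>v\<close> that are already placed are pairwise non-adjacent, so \<open>v\<close>
  together with \<open>N\<close> spans a star. Stars are complete bipartite and hence well-measured, and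
  disintegrating the star measure over \<open>J\<^sup>N\<close> gives a conditional law of \<open>v\<close> given its placed neighbours.
  The Markov property and normalization determine the measures of independent sets and of stars
  (\<open>independent_set_unique\<close>, \<open>star_unique\<close>), so this law does not depend on which well-measured subgraph it
  was taken from (\<open>canonical_kernel\<close>). In turn, every normalized Markovian family on a subgraph is
  obtained by placing the vertices with these laws, in any order (\<open>markov_extension\<close>,
  \<open>family_integral\<close>).

  The crucial point is that for the whole graph the result does not depend on the order either
  (\<open>order_independent\<close>). Suppose this is known for all proper subsets of a vertex set \<open>T\<close>. Then
  only the choice of the last vertex matters, and non-adjacent vertices \<open>a\<close>, \<open>b\<close> are equivalent as last
  vertices: neither kernel looks at the other vertex, so by Fubini's theorem \<open>a\<close>, \<open>b\<close> may be swapped at the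
  end. If the complement of the graph on \<open>T\<close> is connected, all choices are equivalent. If it is not, then
  \<open>T\<close> is the join of two nonempty parts, which have no inner edges because there are no triangles. So
  \<open>T\<close> spans a complete bipartite graph, and the hypothesis gives a family whose measure on \<open>J\<^sup>T\<close> is the
  result of every order.

  With \<open>\<mu>\<^sub>T\<close> defined by any order of \<open>T\<close>, and \<open>\<nu>\<^sub>S\<^sub>,\<^sub>T\<^sub>,\<^sub>x\<close> by placing the vertices of \<open>T - S\<close> starting from \<open>x\<close>, the
  disintegration holds because the order may begin with \<open>S\<close>. It implies that the family is decreasing. For
  the Markov property, sets \<open>U - S\<close> and \<open>W - S\<close> without edges between them are placed independently of each
  other (\<open>iter_product\<close>). On edges the family is normalized because a single edge is complete bipartite.
\<close>

section \<open>Finite kernels\<close>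

text \<open>The conditional measure of a vertex given its neighbours has finite mass at every point, but
  the mass has no uniform bound. Such a kernel is therefore not a map into
  \<^const>\<open>subprob_algebra\<close>; up to a finite weight function it is one.\<close>

definition finite_kernel :: "'b measure \<Rightarrow> 'c measure \<Rightarrow> ('b \<Rightarrow> 'c measure) \<Rightarrow> bool" where
  "finite_kernel M N K \<longleftrightarrow>
     (\<forall>x\<in>space M. sets (K x) = sets N \<and> finite_measure (K x)) \<and>
     (\<forall>A\<in>sets N. (\<lambda>x. emeasure (K x) A) \<in> borel_measurable M)"

lemma finite_kernelD:
  assumes "finite_kernel M N K"
  shows "x \<in> space M \<Longrightarrow> sets (K x) = sets N" "x \<in> space M \<Longrightarrow> finite_measure (K x)"
    "A \<in> sets N \<Longrightarrow> (\<lambda>x. emeasure (K x) A) \<in> borel_measurable M"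
  using assms by (auto simp: finite_kernel_def)

lemma finite_kernel_space:
  assumes "finite_kernel M N K" "x \<in> space M" shows "space (K x) = space N"
  by (rule sets_eq_imp_space_eq[OF finite_kernelD(1)[OF assms]])

lemma finite_kernel_comp:
  assumes K: "finite_kernel M N K" and g: "g \<in> measurable L M"
  shows "finite_kernel L N (\<lambda>x. K (g x))"
  unfolding finite_kernel_def
proof (intro conjI ballI)
  fix x assume "x \<in> space L"
  then have "g x \<in> space M" using g by (rule measurable_space[rotated])
  then show "sets (K (g x)) = sets N" "finite_measure (K (g x))"
    using finite_kernelD[OF K] by auto
next
  fix A assume "A \<in> sets N"
  from measurable_compose[OF g finite_kernelD(3)[OF K this]]
  show "(\<lambda>x. emeasure (K (g x)) A) \<in> borel_measurable L" .
qed

text \<open>Dividing by the total mass \<open>c x\<close> turns a finite kernel into a subprobability kernel. This makes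
  the measurability results of the Giry monad available for finite kernels.\<close>

lemma finite_kernel_normalize:
  assumes K: "finite_kernel M N K" and ne: "space N \<noteq> {}"
  obtains c K' where "c \<in> borel_measurable M" "K' \<in> measurable M (subprob_algebra N)"
    "\<And>x f. x \<in> space M \<Longrightarrow> f \<in> borel_measurable N \<Longrightarrow>
       (\<integral>\<^sup>+ y. f y \<partial>K x) = c x * (\<integral>\<^sup>+ y. f y \<partial>K' x)"
proof -
  define c where "c x = emeasure (K x) (space N)" for x
  define K' where "K' x = scale_measure (inverse (c x)) (K x)" for x
  have c: "c \<in> borel_measurable M"
    unfolding c_def by (rule finite_kernelD(3)[OF K sets.top])
  have fin: "c x < top" if "x \<in> space M" for x
    using finite_measure.emeasure_finite[OF finite_kernelD(2)[OF K that]]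
    by (simp add: c_def less_top)
  have "K' \<in> measurable M (subprob_algebra N)"
  proof (rule measurable_subprob_algebra)
    fix x assume x: "x \<in> space M"
    show "sets (K' x) = sets N"
      using finite_kernelD(1)[OF K x] by (simp add: K'_def)
    have sp: "space (K' x) = space N"
      by (rule sets_eq_imp_space_eq) fact
    (* where c x = 0, the inverse is infinite, but it scales the null measure *)
    have "inverse (c x) * c x \<le> 1"
      using fin[OF x] by (cases "c x = 0") (auto simp: ennreal_inverse_mult ennreal_divide_self divide_ennreal_def[symmetric] mult.commute)
    then show "subprob_space (K' x)"
      by (intro subprob_spaceI) (use sp ne in \<open>auto simp: K'_def c_def\<close>)
  next
    fix A assume A: "A \<in> sets N"
    show "(\<lambda>x. emeasure (K' x) A) \<in> borel_measurable M"
      using c finite_kernelD(3)[OF K A] by (simp add: K'_def)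
  qed
  moreover have "(\<integral>\<^sup>+ y. f y \<partial>K x) = c x * (\<integral>\<^sup>+ y. f y \<partial>K' x)"
    if x: "x \<in> space M" and f: "f \<in> borel_measurable N" for x f
  proof -
    have f': "f \<in> borel_measurable (K x)"
      using f finite_kernelD(1)[OF K x] by (simp cong: measurable_cong_sets)
    show ?thesis
    proof (cases "c x = 0")
      case True
      then have "emeasure (K x) (space (K x)) = 0"
        by (simp add: c_def finite_kernel_space[OF K x])
      then have "AE y in K x. f y = 0"
        by (rule emeasure_0_AE)
      then have "(\<integral>\<^sup>+ y. f y \<partial>K x) = 0"
        using f' by (simp add: nn_integral_0_iff_AE)
      then show ?thesis using True by simp
    next
      case False
      have "c x * inverse (c x) = 1"
        using False fin[OF x] by (simp add: ennreal_divide_self divide_ennreal_def[symmetric])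
      then show ?thesis
        unfolding K'_def by (simp add: nn_integral_scale_measure[OF f'] mult.assoc[symmetric])
    qed
  qed
  ultimately show thesis using c that by blast
qed

lemma finite_kernel_measurable_integral:
  assumes K: "finite_kernel M N K" and ne: "space N \<noteq> {}"
    and f: "(\<lambda>(x, y). f x y) \<in> borel_measurable (M \<Otimes>\<^sub>M N)"
  shows "(\<lambda>x. \<integral>\<^sup>+ y. f x y \<partial>K x) \<in> borel_measurable M"
proof -
  obtain c K' where c: "c \<in> borel_measurable M" and K': "K' \<in> measurable M (subprob_algebra N)"
    and eq: "\<And>x g. x \<in> space M \<Longrightarrow> g \<in> borel_measurable N \<Longrightarrow>
       (\<integral>\<^sup>+ y. g y \<partial>K x) = c x * (\<integral>\<^sup>+ y. g y \<partial>K' x)"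
    using finite_kernel_normalize[OF K ne] by metis
  have "(\<lambda>x. c x * (\<integral>\<^sup>+ y. f x y \<partial>K' x)) \<in> borel_measurable M"
    using c nn_integral_measurable_subprob_algebra2[OF f K'] by simp
  then show ?thesis
  proof (rule measurable_cong[THEN iffD1, rotated])
    fix x assume x: "x \<in> space M"
    have "f x \<in> borel_measurable N"
      using measurable_Pair2[OF f x] by simp
    then show "c x * (\<integral>\<^sup>+ y. f x y \<partial>K' x) = (\<integral>\<^sup>+ y. f x y \<partial>K x)"
      using eq[OF x] by simp
  qed
qed

text \<open>The monadic bind imposes no finiteness on its first argument, so the weight \<open>c\<close> can be moved into
  a density of \<open>M\<close> and the normalized kernel bound afterwards.\<close>

lemma measure_composed_with_kernel:
  assumes K: "finite_kernel X N K" and ne: "space N \<noteq> {}" "space X \<noteq> {}"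
    and M: "sets M = sets X"
    and g: "(\<lambda>(x, y). g x y) \<in> measurable (X \<Otimes>\<^sub>M N) Y"
  obtains L where "sets L = sets Y"
    "\<And>f. f \<in> borel_measurable Y \<Longrightarrow>
       (\<integral>\<^sup>+ z. f z \<partial>L) = (\<integral>\<^sup>+ x. \<integral>\<^sup>+ y. f (g x y) \<partial>K x \<partial>M)"
proof -
  obtain c K' where c: "c \<in> borel_measurable X" and K': "K' \<in> measurable X (subprob_algebra N)"
    and eq: "\<And>x g. x \<in> space X \<Longrightarrow> g \<in> borel_measurable N \<Longrightarrow>
       (\<integral>\<^sup>+ y. g y \<partial>K x) = c x * (\<integral>\<^sup>+ y. g y \<partial>K' x)"
    using finite_kernel_normalize[OF K ne(1)] by metis
  have sp: "space M = space X" by (rule sets_eq_imp_space_eq[OF M])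
  have c': "c \<in> borel_measurable M" using c M by (simp cong: measurable_cong_sets)
  define D where "D x = distr (K' x) Y (g x)" for x
  have D: "D \<in> measurable X (subprob_algebra Y)"
    unfolding D_def by (rule measurable_distr2[OF g K'])
  have D': "D \<in> measurable (density M c) (subprob_algebra Y)"
    using D M by (simp cong: measurable_cong_sets)
  define L where "L = bind (density M c) D"
  have "sets L = sets Y"
    unfolding L_def by (rule sets_bind_measurable[OF D']) (use sp ne in simp)
  moreover have "(\<integral>\<^sup>+ z. f z \<partial>L) = (\<integral>\<^sup>+ x. \<integral>\<^sup>+ y. f (g x y) \<partial>K x \<partial>M)"
    if f: "f \<in> borel_measurable Y" for f
  proof -
    have "(\<lambda>x. \<integral>\<^sup>+ z. f z \<partial>D x) \<in> borel_measurable X"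
      by (rule measurable_compose[OF D nn_integral_measurable_subprob_algebra[OF f]])
    then have D2: "(\<lambda>x. \<integral>\<^sup>+ z. f z \<partial>D x) \<in> borel_measurable M"
      using M by (simp cong: measurable_cong_sets)
    have "(\<integral>\<^sup>+ z. f z \<partial>L) = (\<integral>\<^sup>+ x. \<integral>\<^sup>+ z. f z \<partial>D x \<partial>density M c)"
      unfolding L_def by (rule nn_integral_bind[OF f D'])
    also have "\<dots> = (\<integral>\<^sup>+ x. c x * (\<integral>\<^sup>+ z. f z \<partial>D x) \<partial>M)"
      by (rule nn_integral_density[OF c' D2])
    also have "\<dots> = (\<integral>\<^sup>+ x. \<integral>\<^sup>+ y. f (g x y) \<partial>K x \<partial>M)"
    proof (rule nn_integral_cong)
      fix x assume "x \<in> space M"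
      then have x: "x \<in> space X" by (simp add: sp)
      have gx: "g x \<in> measurable N Y" using measurable_Pair2[OF g x] by simp
      have "sets (K' x) = sets N" by (rule sets_kernel[OF K' x])
      then have gx': "g x \<in> measurable (K' x) Y" using gx by (simp cong: measurable_cong_sets)
      have "(\<integral>\<^sup>+ z. f z \<partial>D x) = (\<integral>\<^sup>+ y. f (g x y) \<partial>K' x)"
        unfolding D_def by (rule nn_integral_distr[OF gx']) (use f in simp)
      then show "c x * (\<integral>\<^sup>+ z. f z \<partial>D x) = (\<integral>\<^sup>+ y. f (g x y) \<partial>K x)"
        using eq[OF x measurable_compose[OF gx f]] by simp
    qed
    finally show ?thesis .
  qed
  ultimately show thesis by (rule that)
qed

section \<open>Placing vertices one after the other\<close>

text \<open>\<open>\<kappa> v N x\<close> plays the role of the law of the position of \<open>v\<close> when its neighbours in the set \<open>N\<close>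
  have been placed at \<open>x\<close>. Nothing is assumed yet about the relation between the kernels of different
  vertices.\<close>

locale kernel_system =
  fixes J :: "'a measure" and V :: "'v set" and E :: "'v \<Rightarrow> 'v \<Rightarrow> bool"
    and \<kappa> :: "'v \<Rightarrow> 'v set \<Rightarrow> ('v \<Rightarrow> 'a) \<Rightarrow> 'a measure"
  assumes nonempty: "space J \<noteq> {}"
    and E_sym: "E u v \<Longrightarrow> E v u"
    and kernel: "v \<in> V \<Longrightarrow> N \<subseteq> V \<Longrightarrow> (\<And>u. u \<in> N \<Longrightarrow> E v u) \<Longrightarrow>
      finite_kernel (powM J N) J (\<kappa> v N)"
begin

definition nbrs :: "'v \<Rightarrow> 'v set \<Rightarrow> 'v set" where
  "nbrs v S = {u \<in> S. E v u}"

text \<open>A new vertex looks only at those of its neighbours that are already placed.\<close>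

definition step :: "'v \<Rightarrow> 'v set \<Rightarrow> ('v \<Rightarrow> 'a) \<Rightarrow> 'a measure" where
  "step v S x = \<kappa> v (nbrs v S) (restrict x (nbrs v S))"

text \<open>The integral of \<open>f\<close> over all ways to extend the placement \<open>x\<close> of \<open>S\<close> by the vertices of the list,
  placed one after the other from left to right. Working with this functional rather than with
  measures makes every composition an equation between functions.\<close>

fun iter :: "'v set \<Rightarrow> 'v list \<Rightarrow> (('v \<Rightarrow> 'a) \<Rightarrow> ennreal) \<Rightarrow> ('v \<Rightarrow> 'a) \<Rightarrow> ennreal" where
  "iter S [] f x = f x"
| "iter S (v # vs) f x = (\<integral>\<^sup>+ a. iter (insert v S) vs f (x(v := a)) \<partial>step v S x)"

lemma nbrs_subset: "nbrs v S \<subseteq> S"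
  by (auto simp: nbrs_def)

lemma step_finite_kernel:
  assumes "v \<in> V" "S \<subseteq> V"
  shows "finite_kernel (powM J S) J (step v S)"
  unfolding step_def
  by (rule finite_kernel_comp[OF kernel measurable_restrict_subset])
     (use assms in \<open>auto simp: nbrs_def\<close>)

lemma step_local:
  assumes "nbrs v S = nbrs v S'" "\<And>u. u \<in> nbrs v S \<Longrightarrow> x u = x' u"
  shows "step v S x = step v S' x'"
proof -
  have "restrict x (nbrs v S) = restrict x' (nbrs v S')"
    using assms by (auto simp: restrict_def)
  then show ?thesis using assms by (simp add: step_def)
qed

lemma space_powM_ne: "space (powM J S) \<noteq> {}"
  using nonempty by (simp add: space_PiM PiE_eq_empty_iff)

lemma upd_in_space:
  assumes "x \<in> space (powM J S)" "a \<in> space J"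
  shows "x(v := a) \<in> space (powM J (insert v S))"
  using assms by (auto simp: space_PiM PiE_def extensional_def)

lemma upd_measurable: "(\<lambda>(x, a). x(v := a)) \<in> measurable (powM J S \<Otimes>\<^sub>M J) (powM J (insert v S))"
  by (rule measurable_add_dim)

lemma upd_measurable1:
  assumes "x \<in> space (powM J S)"
  shows "(\<lambda>a. x(v := a)) \<in> measurable J (powM J (insert v S))"
  using measurable_Pair2[OF upd_measurable assms] by simp

lemma iter_append: "iter S (vs @ ws) f x = iter S vs (iter (S \<union> set vs) ws f) x"
  by (induction vs arbitrary: S x) (simp_all add: insert_commute Un_commute)

lemma iter_measurable:
  assumes "f \<in> borel_measurable (powM J (S \<union> set vs))" "S \<subseteq> V" "set vs \<subseteq> V"
  shows "iter S vs f \<in> borel_measurable (powM J S)"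
  using assms
proof (induction vs arbitrary: S)
  case Nil
  have "iter S [] f = f" by (rule ext) simp
  then show ?case using Nil by simp
next
  case (Cons v vs)
  have "iter (insert v S) vs f \<in> borel_measurable (powM J (insert v S))"
    using Cons.prems by (intro Cons.IH) auto
  from measurable_compose[OF upd_measurable this]
  have "(\<lambda>(x, a). iter (insert v S) vs f (x(v := a))) \<in> borel_measurable (powM J S \<Otimes>\<^sub>M J)"
    by (simp add: split_beta')
  moreover have "finite_kernel (powM J S) J (step v S)"
    using Cons.prems by (intro step_finite_kernel) auto
  ultimately have "(\<lambda>x. \<integral>\<^sup>+ a. iter (insert v S) vs f (x(v := a)) \<partial>step v S x)
      \<in> borel_measurable (powM J S)"
    by (intro finite_kernel_measurable_integral[OF _ nonempty])
  moreover have "iter S (v # vs) f = (\<lambda>x. \<integral>\<^sup>+ a. iter (insert v S) vs f (x(v := a)) \<partial>step v S x)"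
    by (rule ext) simp
  ultimately show ?case by simp
qed

lemma space_step:
  "v \<in> V \<Longrightarrow> S \<subseteq> V \<Longrightarrow> x \<in> space (powM J S) \<Longrightarrow> space (step v S x) = space J"
  by (rule finite_kernel_space[OF step_finite_kernel])

text \<open>Only the values of the integrands at extensions of \<open>x\<close> matter.\<close>

lemma iter_mono:
  assumes "S \<subseteq> V" "set vs \<subseteq> V" "x \<in> space (powM J S)" "distinct vs" "set vs \<inter> S = {}"
    and "\<And>z. z \<in> space (powM J (S \<union> set vs)) \<Longrightarrow> restrict z S = x \<Longrightarrow> f z \<le> g z"
  shows "iter S vs f x \<le> iter S vs g x"
  using assms
proof (induction vs arbitrary: S x)
  case Nil
  then show ?case by (simp add: space_PiM extensional_restrict PiE_def)
next
  case (Cons v vs)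
  have "iter (insert v S) vs f (x(v := a)) \<le> iter (insert v S) vs g (x(v := a))"
    if "a \<in> space (step v S x)" for a
  proof (rule Cons.IH)
    have "a \<in> space J" using that Cons.prems space_step[of v S x] by auto
    then show "x(v := a) \<in> space (powM J (insert v S))"
      using Cons.prems by (intro upd_in_space)
    fix z assume z: "z \<in> space (powM J (insert v S \<union> set vs))" "restrict z (insert v S) = x(v := a)"
    have "restrict z S = restrict (restrict z (insert v S)) S"
      by (simp add: restrict_restrict Int_absorb1 subset_insertI)
    also have "\<dots> = restrict (x(v := a)) S"
      by (simp only: z(2))
    also have "\<dots> = x"
      using Cons.prems by (auto simp: space_PiM PiE_def extensional_def restrict_def)
    finally have r: "restrict z S = x" .
    show "f z \<le> g z"
      by (rule Cons.prems(6)[OF _ r]) (use z(1) in simp)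
  qed (use Cons.prems in auto)
  then show ?case by (auto intro: nn_integral_mono)
qed

lemma iter_cong:
  assumes "S \<subseteq> V" "set vs \<subseteq> V" "x \<in> space (powM J S)" "distinct vs" "set vs \<inter> S = {}"
    and "\<And>z. z \<in> space (powM J (S \<union> set vs)) \<Longrightarrow> restrict z S = x \<Longrightarrow> f z = g z"
  shows "iter S vs f x = iter S vs g x"
  using iter_mono[OF assms(1-5), of f g] iter_mono[OF assms(1-5), of g f] assms(6)
  by (intro antisym) auto

lemma iter_measure:
  assumes "S \<subseteq> V" "set vs \<subseteq> V" "x \<in> space (powM J S)"
  shows "\<exists>M. sets M = sets (powM J (S \<union> set vs)) \<and>
    (\<forall>f\<in>borel_measurable (powM J (S \<union> set vs)). (\<integral>\<^sup>+ z. f z \<partial>M) = iter S vs f x)"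
  using assms(2)
proof (induction vs rule: rev_induct)
  case Nil
  have "(\<integral>\<^sup>+ z. f z \<partial>return (powM J S) x) = f x" if "f \<in> borel_measurable (powM J S)" for f
    using assms(3) that by (rule nn_integral_return)
  then show ?case
    by (intro exI[of _ "return (powM J S) x"]) auto
next
  case (snoc v vs)
  let ?T = "S \<union> set vs"
  from snoc obtain M where M: "sets M = sets (powM J ?T)"
    and Mi: "\<And>f. f \<in> borel_measurable (powM J ?T) \<Longrightarrow> (\<integral>\<^sup>+ z. f z \<partial>M) = iter S vs f x"
    by auto
  have k: "finite_kernel (powM J ?T) J (step v ?T)"
    using snoc.prems assms by (intro step_finite_kernel) auto
  obtain L where L: "sets L = sets (powM J (insert v ?T))"
    and Li: "\<And>f. f \<in> borel_measurable (powM J (insert v ?T)) \<Longrightarrow>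
       (\<integral>\<^sup>+ z. f z \<partial>L) = (\<integral>\<^sup>+ x. \<integral>\<^sup>+ a. f (x(v := a)) \<partial>step v ?T x \<partial>M)"
    by (rule measure_composed_with_kernel[OF k nonempty space_powM_ne M upd_measurable]) (rule that)
  have "(\<integral>\<^sup>+ z. f z \<partial>L) = iter S (vs @ [v]) f x"
    if f: "f \<in> borel_measurable (powM J (insert v ?T))" for f
  proof -
    have "iter ?T [v] f \<in> borel_measurable (powM J ?T)"
      using snoc.prems assms f by (intro iter_measurable) auto
    from Mi[OF this] show ?thesis
      by (simp add: Li[OF f] iter_append)
  qed
  then show ?case using L by (intro exI[of _ L]) auto
qed

text \<open>The factor \<open>1 / (1 + c)\<close>, where \<open>c\<close> is the mass of the step that places a new vertex, compensates
  this mass. The product of these factors is a positive function of bounded integral, which shows that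
  the measures defined by \<open>iter\<close> are sigma-finite.\<close>

lemma iter_bounded_weight:
  assumes "S \<subseteq> V" "set vs \<subseteq> V" "distinct vs" "set vs \<inter> S = {}"
  shows "\<exists>h\<in>borel_measurable (powM J (S \<union> set vs)). (\<forall>z\<in>space (powM J (S \<union> set vs)). h z > 0) \<and>
    (\<forall>x\<in>space (powM J S). iter S vs h x \<le> 1)"
  using assms(2-)
proof (induction vs rule: rev_induct)
  case Nil
  then show ?case by (intro bexI[of _ "\<lambda>_. 1"]) auto
next
  case (snoc v vs)
  let ?T = "S \<union> set vs"
  from snoc obtain h where h: "h \<in> borel_measurable (powM J ?T)"
    and pos: "\<And>z. z \<in> space (powM J ?T) \<Longrightarrow> h z > 0"
    and le: "\<And>x. x \<in> space (powM J S) \<Longrightarrow> iter S vs h x \<le> 1"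
    by auto
  have TV: "?T \<subseteq> V" "v \<in> V" "v \<notin> ?T" using snoc.prems assms by auto
  note k = step_finite_kernel[OF TV(2,1)]
  define c where "c z = emeasure (step v ?T z) (space J)" for z
  have c: "c \<in> borel_measurable (powM J ?T)"
    unfolding c_def by (rule finite_kernelD(3)[OF k sets.top])
  have c_fin: "c z < top" if "z \<in> space (powM J ?T)" for z
    using finite_measure.emeasure_finite[OF finite_kernelD(2)[OF k that]]
    by (simp add: c_def less_top)
  define g where "g z = h z / (1 + c z)" for z
  have g: "g \<in> borel_measurable (powM J ?T)"
    unfolding g_def using h c by measurable
  define h' where "h' z = g (restrict z ?T)" for z
  have r: "(\<lambda>z. restrict z ?T) \<in> measurable (powM J (insert v ?T)) (powM J ?T)"
    by (rule measurable_restrict_subset) auto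
  have h': "h' \<in> borel_measurable (powM J (insert v ?T))"
    unfolding h'_def by (rule measurable_compose[OF r g])
  have "h' z > 0" if "z \<in> space (powM J (insert v ?T))" for z
  proof -
    have rz: "restrict z ?T \<in> space (powM J ?T)" by (rule measurable_space[OF r that])
    have "1 + c (restrict z ?T) < top" using c_fin[OF rz] by (simp add: less_top)
    then show ?thesis
      using pos[OF rz] by (simp add: h'_def g_def ennreal_zero_less_divide)
  qed
  moreover have "iter S (vs @ [v]) h' x \<le> 1" if x: "x \<in> space (powM J S)" for x
  proof -
    have "iter S (vs @ [v]) h' x = iter S vs (iter ?T [v] h') x"
      by (simp only: iter_append)
    also have "\<dots> \<le> iter S vs h x"
    proof (rule iter_mono)
      fix z assume z: "z \<in> space (powM J ?T)"
      have "(\<integral>\<^sup>+ a. h' (z(v := a)) \<partial>step v ?T z) = (\<integral>\<^sup>+ a. g z \<partial>step v ?T z)"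
      proof (rule nn_integral_cong)
        fix a
        have "restrict (z(v := a)) ?T = z"
          using z TV(3) by (auto simp: space_PiM PiE_def extensional_def restrict_def)
        then show "h' (z(v := a)) = g z" by (simp add: h'_def)
      qed
      also have "\<dots> = g z * c z"
        using space_step[OF TV(2,1) z] by (simp add: c_def)
      also have "\<dots> = h z * (c z / (1 + c z))"
        by (simp add: g_def divide_ennreal_def mult_ac)
      also have "\<dots> \<le> h z * 1"
      proof (rule mult_left_mono)
        have "c z / (1 + c z) \<le> (1 + c z) / (1 + c z)"
          by (rule divide_right_mono_ennreal) simp
        also have "\<dots> = 1"
          using c_fin[OF z] by (intro ennreal_divide_self) (auto simp: less_top)
        finally show "c z / (1 + c z) \<le> 1" .
      qed simp
      finally show "iter ?T [v] h' z \<le> h z" by simp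
    qed (use snoc.prems assms x in auto)
    also have "\<dots> \<le> 1" by (rule le[OF x])
    finally show ?thesis .
  qed
  ultimately show ?case
    using h' by (intro bexI[of _ h']) auto
qed

end

text \<open>By Markov's inequality, the sets on which \<open>h \<ge> 1 / (n + 1)\<close> have finite measure.\<close>

lemma sigma_finite_by_weight:
  assumes h: "h \<in> borel_measurable M" "\<And>x. x \<in> space M \<Longrightarrow> h x > 0"
    and fin: "(\<integral>\<^sup>+ x. h x \<partial>M) < (top :: ennreal)"
  shows "sigma_finite_measure M"
proof
  define A where "A n = {x \<in> space M. 1 \<le> of_nat (Suc n) * h x}" for n :: nat
  have A: "A n \<in> sets M" for n
    unfolding A_def using h(1) by measurable
  have "emeasure M (A n) < top" for n
  proof -
    have "emeasure M (A n) \<le> of_nat (Suc n) * (\<integral>\<^sup>+ x. h x * indicator (space M) x \<partial>M)"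
      unfolding A_def by (rule nn_integral_Markov_inequality) (use h(1) in auto)
    also have "(\<integral>\<^sup>+ x. h x * indicator (space M) x \<partial>M) = (\<integral>\<^sup>+ x. h x \<partial>M)"
      by (rule nn_integral_cong) simp
    also have "of_nat (Suc n) * (\<integral>\<^sup>+ x. h x \<partial>M) < top"
      using fin by (simp only: ennreal_mult_less_top of_nat_less_top simp_thms)
    finally show ?thesis .
  qed
  then have "emeasure M (A n) \<noteq> \<infinity>" for n
    unfolding infinity_ennreal_def by (rule less_imp_neq)
  moreover have "(\<Union>n. A n) = space M"
  proof (intro equalityI subsetI)
    fix x assume x: "x \<in> space M"
    have "\<exists>n. 1 \<le> of_nat (Suc n) * h x"
    proof (cases "h x = top")
      case True
      then show ?thesis by (intro exI[of _ 0]) simp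
    next
      case False
      then obtain r where r: "h x = ennreal r" "r > 0"
        using h(2)[OF x] by (cases "h x") (auto simp: ennreal_less_zero_iff)
      obtain n where "1 / r < real n" using reals_Archimedean2 by blast
      then have "1 \<le> real (Suc n) * r" using r by (simp add: field_simps)
      then have "ennreal 1 \<le> ennreal (real (Suc n) * r)" by (rule ennreal_leI)
      also have "\<dots> = of_nat (Suc n) * h x"
        using r by (subst ennreal_mult) (auto simp del: of_nat_Suc simp add: ennreal_of_nat_eq_real_of_nat)
      finally show ?thesis by (intro exI[of _ n]) (simp only: ennreal_1)
    qed
    then show "x \<in> (\<Union>n. A n)" using x by (auto simp: A_def)
  qed (auto simp: A_def)
  ultimately show "\<exists>A. countable A \<and> A \<subseteq> sets M \<and> \<Union> A = space M \<and> (\<forall>a\<in>A. emeasure M a \<noteq> \<infinity>)"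
    using A by (intro exI[of _ "range A"]) auto
qed

context kernel_system
begin

lemma step_upd_nonadjacent:
  assumes "\<not> E v u"
  shows "step v (insert u S) (x(u := a)) = step v S x"
  by (rule step_local) (use assms in \<open>auto simp: nbrs_def\<close>)

lemma iter_Cons_cong:
  assumes "v \<in> V" "S \<subseteq> V" "x \<in> space (powM J S)"
    and "\<And>y. y \<in> space (powM J (insert v S)) \<Longrightarrow>
      iter (insert v S) vs f y = iter (insert v S) ws g y"
  shows "iter S (v # vs) f x = iter S (v # ws) g x"
  using assms by (auto intro!: nn_integral_cong assms(4) upd_in_space simp: space_step)

text \<open>Two non-adjacent vertices do not see each other, so this is Fubini's theorem for two fixed finite
  measures; the equality holds at every \<open>x\<close>.\<close>

lemma iter_swap:
  assumes uv: "\<not> E u v" "u \<noteq> v" "u \<in> V" "v \<in> V" and S: "S \<subseteq> V" "x \<in> space (powM J S)"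
    and f: "f \<in> borel_measurable (powM J (insert u (insert v S)))"
  shows "iter S [u, v] f x = iter S [v, u] f x"
proof -
  have vu: "\<not> E v u" using uv(1) E_sym by blast
  note ku = step_finite_kernel[OF uv(3) S(1)] and kv = step_finite_kernel[OF uv(4) S(1)]
  interpret u: finite_measure "step u S x" by (rule finite_kernelD(2)[OF ku S(2)])
  interpret v: finite_measure "step v S x" by (rule finite_kernelD(2)[OF kv S(2)])
  interpret pair_sigma_finite "step v S x" "step u S x" ..
  have "(\<lambda>(b, a). x(u := a, v := b)) = (\<lambda>(y, b). y(v := b)) \<circ> (\<lambda>(b, a). (x(u := a), b))"
    by auto
  moreover have "(\<lambda>(b, a). (x(u := a), b)) \<in> measurable (J \<Otimes>\<^sub>M J) (powM J (insert u S) \<Otimes>\<^sub>M J)"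
    unfolding split_beta'
    by (intro measurable_Pair measurable_compose[OF measurable_snd upd_measurable1[OF S(2)]] measurable_fst)
  ultimately have "(\<lambda>(b, a). x(u := a, v := b)) \<in> measurable (J \<Otimes>\<^sub>M J) (powM J (insert u (insert v S)))"
    using upd_measurable[of v "insert u S"] by (simp add: insert_commute measurable_comp)
  from measurable_compose[OF this f]
  have "(\<lambda>(b, a). f (x(u := a, v := b))) \<in> borel_measurable (J \<Otimes>\<^sub>M J)"
    by (simp add: split_beta')
  also have "borel_measurable (J \<Otimes>\<^sub>M J) = borel_measurable (step v S x \<Otimes>\<^sub>M step u S x)"
    using finite_kernelD(1)[OF ku S(2)] finite_kernelD(1)[OF kv S(2)]
    by (intro measurable_cong_sets sets_pair_measure_cong) auto
  finally have "(\<integral>\<^sup>+ a. \<integral>\<^sup>+ b. f (x(u := a, v := b)) \<partial>step v S x \<partial>step u S x) =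
      (\<integral>\<^sup>+ b. \<integral>\<^sup>+ a. f (x(u := a, v := b)) \<partial>step u S x \<partial>step v S x)"
    by (rule Fubini')
  then show ?thesis
    using uv(2) by (simp add: step_upd_nonadjacent[OF uv(1)] step_upd_nonadjacent[OF vu] fun_upd_twist)
qed

lemma iter_swap_Cons:
  assumes uv: "\<not> E u v" "u \<noteq> v" "u \<in> V" "v \<in> V" and S: "S \<subseteq> V" "x \<in> space (powM J S)"
    and ws: "set ws \<subseteq> V" and f: "f \<in> borel_measurable (powM J (insert u (insert v (S \<union> set ws))))"
  shows "iter S (u # v # ws) f x = iter S (v # u # ws) f x"
proof -
  have "iter (insert u (insert v S)) ws f \<in> borel_measurable (powM J (insert u (insert v S)))"
    using uv S ws f by (intro iter_measurable) auto
  from iter_swap[OF uv S this] show ?thesis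
    using iter_append[of S "[u, v]" ws f x] iter_append[of S "[v, u]" ws f x]
    by (simp add: insert_commute)
qed

lemma iter_move:
  assumes "u \<in> V" "set ps \<subseteq> V" "set ws \<subseteq> V" "S \<subseteq> V" "x \<in> space (powM J S)" "u \<notin> set ps"
    and "\<And>p. p \<in> set ps \<Longrightarrow> \<not> E u p"
    and "f \<in> borel_measurable (powM J (insert u (set ps \<union> set ws \<union> S)))"
  shows "iter S (u # ps @ ws) f x = iter S (ps @ u # ws) f x"
  using assms(2,4-)
proof (induction ps arbitrary: S x)
  case Nil
  then show ?case by simp
next
  case (Cons p ps)
  have "iter S (u # p # ps @ ws) f x = iter S (p # u # ps @ ws) f x"
    using assms(1,3) Cons.prems by (intro iter_swap_Cons) (auto simp: insert_commute Un_ac)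
  also have "\<dots> = iter S (p # ps @ u # ws) f x"
  proof (rule iter_Cons_cong)
    fix y assume "y \<in> space (powM J (insert p S))"
    then show "iter (insert p S) (u # ps @ ws) f y = iter (insert p S) (ps @ u # ws) f y"
      using Cons.prems by (intro Cons.IH) auto
  qed (use Cons.prems in auto)
  finally show ?case by simp
qed

text \<open>Moving every vertex of \<open>Q\<close> to the right past the vertices of \<open>P\<close> needs only swaps of
  non-adjacent vertices.\<close>

lemma iter_split:
  assumes "set l \<subseteq> P \<union> Q" "P \<inter> Q = {}" "set l \<subseteq> V" "S \<subseteq> V" "x \<in> space (powM J S)" "distinct l"
    and "\<And>p q. p \<in> P \<Longrightarrow> q \<in> Q \<Longrightarrow> \<not> E q p"
    and "f \<in> borel_measurable (powM J (S \<union> set l))"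
  shows "iter S l f x = iter S (filter (\<lambda>v. v \<in> P) l @ filter (\<lambda>v. v \<in> Q) l) f x"
  using assms
proof (induction l arbitrary: S x)
  case Nil
  then show ?case by simp
next
  case (Cons v l)
  let ?p = "filter (\<lambda>v. v \<in> P) l" and ?q = "filter (\<lambda>v. v \<in> Q) l"
  have eq: "set ?p \<union> set ?q = set l" using Cons.prems by auto
  have "iter S (v # l) f x = iter S (v # ?p @ ?q) f x"
  proof (rule iter_Cons_cong)
    fix y assume "y \<in> space (powM J (insert v S))"
    then show "iter (insert v S) l f y = iter (insert v S) (?p @ ?q) f y"
      using Cons.prems by (intro Cons.IH) auto
  qed (use Cons.prems in auto)
  also have "\<dots> = iter S (filter (\<lambda>v. v \<in> P) (v # l) @ filter (\<lambda>v. v \<in> Q) (v # l)) f x"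
  proof (cases "v \<in> P")
    case True
    then show ?thesis using Cons.prems by auto
  next
    case False
    then have v: "v \<in> Q" using Cons.prems by auto
    have "iter S (v # ?p @ ?q) f x = iter S (?p @ v # ?q) f x"
    proof (rule iter_move)
      show "f \<in> borel_measurable (powM J (insert v (set ?p \<union> set ?q \<union> S)))"
        using Cons.prems(8) by (simp only: eq) (simp add: Un_commute)
    qed (use Cons.prems v in auto)
    then show ?thesis using False v by simp
  qed
  finally show ?case .
qed

text \<open>Vertices that have no neighbour in \<open>R\<close> do not react to the placement \<open>z\<close> of \<open>R\<close>.\<close>

lemma iter_local:
  assumes "R \<inter> set ws = {}" "\<And>w r. w \<in> set ws \<Longrightarrow> r \<in> R \<Longrightarrow> \<not> E w r"
  shows "iter (S \<union> R) ws f (override_on x z R) = iter S ws (\<lambda>y. f (override_on y z R)) x"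
  using assms
proof (induction ws arbitrary: S x)
  case Nil
  then show ?case by simp
next
  case (Cons w ws)
  have "step w (S \<union> R) (override_on x z R) = step w S x"
    by (rule step_local) (use Cons.prems in \<open>auto simp: nbrs_def override_on_def\<close>)
  moreover have "(override_on x z R)(w := a) = override_on (x(w := a)) z R" for a
    using Cons.prems by (auto simp: override_on_def)
  ultimately show ?case
    using Cons.IH[of "insert w S"] Cons.prems by simp
qed

text \<open>The Markov property in integrated form: two sets of new vertices without edges between them
  are placed independently, given the placement \<open>x\<close> of \<open>S\<close>.\<close>

lemma iter_product:
  assumes l: "set l \<subseteq> P \<union> Q" "P \<inter> Q = {}" "set l \<subseteq> V" "S \<subseteq> V" "x \<in> space (powM J S)"
      "distinct l" "set l \<inter> S = {}"
    and E: "\<And>p q. p \<in> P \<Longrightarrow> q \<in> Q \<Longrightarrow> \<not> E q p"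
    and f: "f \<in> borel_measurable (powM J (S \<union> set l))"
  shows "iter S l f x =
    iter S (filter (\<lambda>v. v \<in> P) l) (\<lambda>y. iter S (filter (\<lambda>v. v \<in> Q) l) (\<lambda>z. f (override_on z y P)) x) x"
proof -
  let ?p = "filter (\<lambda>v. v \<in> P) l" and ?q = "filter (\<lambda>v. v \<in> Q) l"
  have "iter S l f x = iter S ?p (iter (S \<union> set ?p) ?q f) x"
    using iter_split[OF l(1-6) E f] by (simp only: iter_append)
  also have "\<dots> = iter S ?p (\<lambda>y. iter S ?q (\<lambda>z. f (override_on z y P)) x) x"
  proof (rule iter_cong)
    fix y assume y: "y \<in> space (powM J (S \<union> set ?p))" "restrict y S = x"
    have "override_on x y (set ?p) = y"
      unfolding y(2)[symmetric] using y(1)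
      by (auto simp: fun_eq_iff override_on_def space_PiM PiE_def extensional_def)
    then have "iter (S \<union> set ?p) ?q f y = iter S ?q (\<lambda>z. f (override_on z y (set ?p))) x"
      using iter_local[of "set ?p" ?q S f x y] l E by auto
    also have "\<dots> = iter S ?q (\<lambda>z. f (override_on z y P)) x"
    proof (rule iter_cong)
      fix z assume z: "z \<in> space (powM J (S \<union> set ?q))" "restrict z S = x"
      have "override_on z y (set ?p) k = override_on z y P k" for k
      proof (cases "k \<in> P \<and> k \<notin> set ?p")
        case True
        then have k: "k \<notin> set l" "k \<notin> set ?q" by auto
        show ?thesis
        proof (cases "k \<in> S")
          case True
          then have "y k = x k" "z k = x k"
            using fun_cong[OF y(2), of k] fun_cong[OF z(2), of k] by auto
          then show ?thesis by (simp add: override_on_def)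
        next
          case False
          then show ?thesis using y(1) z(1) k
            by (auto simp: override_on_def space_PiM PiE_def extensional_def)
        qed
      qed (auto simp: override_on_def)
      then show "f (override_on z y (set ?p)) = f (override_on z y P)" by presburger
    qed (use l in auto)
    finally show "iter (S \<union> set ?p) ?q f y = iter S ?q (\<lambda>z. f (override_on z y P)) x" .
  qed (use l in auto)
  finally show ?thesis .
qed

end

section \<open>Extending a Markovian family by one vertex\<close>

text \<open>\<open>K\<close> disintegrates the measure \<open>Q\<close> on \<open>J\<^sup>N\<^sup>\<union>\<^sup>{\<^sup>v\<^sup>}\<close> over the measure \<open>P\<close> on \<open>J\<^sup>N\<close>. As the \<open>K x\<close> are
  finite, it is enough to ask this of rectangles.\<close>

definition conditional_kernel ::
    "'a measure \<Rightarrow> 'v set \<Rightarrow> 'v \<Rightarrow> ('v \<Rightarrow> 'a) measure \<Rightarrow> ('v \<Rightarrow> 'a) measure \<Rightarrow>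
     (('v \<Rightarrow> 'a) \<Rightarrow> 'a measure) \<Rightarrow> bool" where
  "conditional_kernel J N v P Q K \<longleftrightarrow>
     finite_kernel (powM J N) J K \<and>
     (\<forall>D\<in>sets (powM J N). \<forall>A\<in>sets J.
        emeasure Q {z \<in> space (powM J (insert v N)). restrict z N \<in> D \<and> z v \<in> A} =
        (\<integral>\<^sup>+ x\<in>D. emeasure (K x) A \<partial>P))"

text \<open>Rectangles with full second side and finite measure have to cover the space, since for general
  sigma-finite measures on a product all rectangles may have measure zero or infinity.\<close>

lemma measure_eqI_rectangles:
  assumes u: "u \<notin> T"
    and M1: "sets M1 = sets (powM J (insert u T))" and M2: "sets M2 = sets (powM J (insert u T))"
    and eq: "\<And>D A. D \<in> sets (powM J T) \<Longrightarrow> A \<in> sets J \<Longrightarrow>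
      emeasure M1 {z \<in> space (powM J (insert u T)). restrict z T \<in> D \<and> z u \<in> A} =
      emeasure M2 {z \<in> space (powM J (insert u T)). restrict z T \<in> D \<and> z u \<in> A}"
    and C: "range C \<subseteq> sets (powM J T)" "(\<Union>i::nat. C i) = space (powM J T)"
    and fin: "\<And>i. emeasure M1 {z \<in> space (powM J (insert u T)). restrict z T \<in> C i} \<noteq> \<infinity>"
  shows "M1 = M2"
proof -
  let ?Y = "powM J (insert u T)" and ?P = "powM J T \<Otimes>\<^sub>M J"
  define \<phi> where "\<phi> z = (restrict z T, z u)" for z :: "'a \<Rightarrow> 'b"
  define \<psi> where "\<psi> = (\<lambda>(z :: 'a \<Rightarrow> 'b, a). z(u := a))"
  have \<phi>: "\<phi> \<in> measurable ?Y ?P"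
    unfolding \<phi>_def by (intro measurable_Pair measurable_restrict_subset measurable_component_singleton) auto
  have \<psi>: "\<psi> \<in> measurable ?P ?Y"
    unfolding \<psi>_def by (rule measurable_add_dim)
  have inv: "\<psi> (\<phi> z) = z" if "z \<in> space ?Y" for z
    using that u by (auto simp: \<phi>_def \<psi>_def space_PiM PiE_def extensional_def fun_eq_iff)
  have roundtrip: "distr (distr M ?P \<phi>) ?Y \<psi> = M" if M: "sets M = sets ?Y" for M
  proof -
    have \<phi>M: "\<phi> \<in> measurable M ?P" using \<phi> M by (simp cong: measurable_cong_sets)
    have sp: "space M = space ?Y" by (rule sets_eq_imp_space_eq[OF M])
    have "distr (distr M ?P \<phi>) ?Y \<psi> = distr M ?Y (\<psi> \<circ> \<phi>)"
      by (rule distr_distr[OF \<psi> \<phi>M])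
    also have "\<dots> = distr M M (\<lambda>z. z)"
      using inv sp M by (intro distr_cong) auto
    also have "\<dots> = M" by (rule distr_id)
    finally show ?thesis .
  qed
  have rect: "emeasure (distr M ?P \<phi>) (D \<times> A) =
      emeasure M {z \<in> space ?Y. restrict z T \<in> D \<and> z u \<in> A}"
    if M: "sets M = sets ?Y" and "D \<in> sets (powM J T)" "A \<in> sets J" for M D A
  proof -
    have \<phi>M: "\<phi> \<in> measurable M ?P" using \<phi> M by (simp cong: measurable_cong_sets)
    have sp: "space M = space ?Y" by (rule sets_eq_imp_space_eq[OF M])
    have "\<phi> -` (D \<times> A) \<inter> space M = {z \<in> space ?Y. restrict z T \<in> D \<and> z u \<in> A}"
      by (auto simp: \<phi>_def sp)
    then show ?thesis using that \<phi>M by (simp add: emeasure_distr)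
  qed
  have "distr M1 ?P \<phi> = distr M2 ?P \<phi>"
  proof (rule measure_eqI_generator_eq[where \<Omega> = "space (powM J T) \<times> space J"
        and E = "{D \<times> A |D A. D \<in> sets (powM J T) \<and> A \<in> sets J}" and A = "\<lambda>i. C i \<times> space J"])
    show "Int_stable {D \<times> A |D A. D \<in> sets (powM J T) \<and> A \<in> sets J}"
      by (rule Int_stable_pair_measure_generator)
    show "{D \<times> A |D A. D \<in> sets (powM J T) \<and> A \<in> sets J} \<subseteq> Pow (space (powM J T) \<times> space J)"
      by (rule pair_measure_closed)
    show "(\<Union>i. C i \<times> space J) = space (powM J T) \<times> space J" using C(2) by auto
    fix i
    have "emeasure (distr M1 ?P \<phi>) (C i \<times> space J) =
        emeasure M1 {z \<in> space ?Y. restrict z T \<in> C i \<and> z u \<in> space J}"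
      using C(1) by (intro rect[OF M1]) auto
    also have "{z \<in> space ?Y. restrict z T \<in> C i \<and> z u \<in> space J} = {z \<in> space ?Y. restrict z T \<in> C i}"
      by (auto simp: space_PiM)
    finally show "emeasure (distr M1 ?P \<phi>) (C i \<times> space J) \<noteq> \<infinity>" using fin by simp
  next
    show "range (\<lambda>i. C i \<times> space J) \<subseteq> {D \<times> A |D A. D \<in> sets (powM J T) \<and> A \<in> sets J}"
    proof (rule image_subsetI)
      fix i
      have "C i \<in> sets (powM J T)" using C(1) by auto
      then show "C i \<times> space J \<in> {D \<times> A |D A. D \<in> sets (powM J T) \<and> A \<in> sets J}"
        by (intro CollectI exI[of _ "C i"] exI[of _ "space J"]) simp
    qed
    fix R assume "R \<in> {D \<times> A |D A. D \<in> sets (powM J T) \<and> A \<in> sets J}"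
    then obtain D A where R: "R = D \<times> A" and DA: "D \<in> sets (powM J T)" "A \<in> sets J" by auto
    show "emeasure (distr M1 ?P \<phi>) R = emeasure (distr M2 ?P \<phi>) R"
      unfolding R rect[OF M1 DA] rect[OF M2 DA] by (rule eq[OF DA])
  qed (simp_all only: sets_distr sets_pair_measure)
  then have "distr (distr M1 ?P \<phi>) ?Y \<psi> = distr (distr M2 ?P \<phi>) ?Y \<psi>"
    by (rule arg_cong)
  then show ?thesis unfolding roundtrip[OF M1] roundtrip[OF M2] .
qed

lemma slice_measurable:
  assumes "C \<in> sets (powM J T)" "S \<subseteq> T" "x \<in> space (powM J S)"
  shows "slice J S T C x \<in> sets (powM J (T - S))"
proof -
  have "S \<union> (T - S) = T" using assms(2) by auto
  then have "merge S (T - S) \<in> measurable (powM J S \<Otimes>\<^sub>M powM J (T - S)) (powM J T)"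
    using measurable_merge[of S "T - S" "\<lambda>_. J"] by simp
  then have "(\<lambda>y. merge S (T - S) (x, y)) \<in> measurable (powM J (T - S)) (powM J T)"
    by (rule measurable_Pair2[OF _ assms(3)])
  from measurable_sets[OF this assms(1)] show ?thesis
    by (simp add: slice_def vimage_def Int_def conj_commute)
qed

text \<open>A normalized, decreasing and Markovian family together with its disintegrations, for an adjacency
  relation \<open>E\<close> on \<open>X\<close>. A relation is easier to restrict to subsets than a digraph.\<close>

locale markov_family =
  fixes J :: "'a measure" and \<eta> :: "('a \<times> 'a) measure" and E :: "'v \<Rightarrow> 'v \<Rightarrow> bool"
    and X :: "'v set" and \<mu> :: "'v set \<Rightarrow> ('v \<Rightarrow> 'a) measure"
    and \<nu> :: "'v set \<Rightarrow> 'v set \<Rightarrow> ('v \<Rightarrow> 'a) \<Rightarrow> ('v \<Rightarrow> 'a) measure"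
  assumes sets_mu: "S \<subseteq> X \<Longrightarrow> sets (\<mu> S) = sets (powM J S)"
    and sigma_finite: "S \<subseteq> X \<Longrightarrow> sigma_finite_measure (\<mu> S)"
    and vertex: "i \<in> X \<Longrightarrow> \<mu> {i} = distr (marginal J \<eta>) (powM J {i}) (\<lambda>a. \<lambda>k\<in>{i}. a)"
    and edge: "i \<in> X \<Longrightarrow> j \<in> X \<Longrightarrow> E i j \<Longrightarrow>
      \<mu> {i, j} = distr \<eta> (powM J {i, j}) (\<lambda>(a, b). \<lambda>k\<in>{i, j}. if k = i then a else b)"
    and empty: "\<mu> {} = return (powM J {}) (\<lambda>_. undefined)"
    and marginals: "T \<subseteq> X \<Longrightarrow> S \<subseteq> T \<Longrightarrow>
      absolutely_continuous (\<mu> S) (distr (\<mu> T) (powM J S) (\<lambda>x. restrict x S))"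
    and disint: "T \<subseteq> X \<Longrightarrow> S \<subseteq> T \<Longrightarrow> disintegration J \<mu> S T (\<nu> S T)"
    and markov: "U \<subseteq> X \<Longrightarrow> W \<subseteq> X \<Longrightarrow> S = U \<inter> W \<Longrightarrow>
      (\<And>u w. u \<in> U - S \<Longrightarrow> w \<in> W - S \<Longrightarrow> \<not> E u w) \<Longrightarrow>
      AE x in \<mu> S. \<nu> S (U \<union> W) x = prodM J (U - S) (W - S) (\<nu> S U x) (\<nu> S W x)"
begin

lemma space_mu: "S \<subseteq> X \<Longrightarrow> space (\<mu> S) = space (powM J S)"
  by (rule sets_eq_imp_space_eq[OF sets_mu])

lemma borel_mu: "S \<subseteq> X \<Longrightarrow> f \<in> borel_measurable (powM J S) \<Longrightarrow> f \<in> borel_measurable (\<mu> S)"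
  using sets_mu by (simp cong: measurable_cong_sets)

lemma sets_nu:
  "T \<subseteq> X \<Longrightarrow> S \<subseteq> T \<Longrightarrow> x \<in> space (powM J S) \<Longrightarrow> sets (\<nu> S T x) = sets (powM J (T - S))"
  using disint by (auto simp: disintegration_def)

lemma
  assumes "T \<subseteq> X" "S \<subseteq> T" "C \<in> sets (powM J T)"
  shows nu_slice_measurable: "(\<lambda>x. emeasure (\<nu> S T x) (slice J S T C x)) \<in> borel_measurable (powM J S)"
    and emeasure_mu: "emeasure (\<mu> T) C = (\<integral>\<^sup>+ x. emeasure (\<nu> S T x) (slice J S T C x) \<partial>\<mu> S)"
  using disint[OF assms(1,2)] assms(3) by (auto simp: disintegration_def)

text \<open>Both sides are the integral of \<open>f\<close> against the marginal on \<open>J\<^sup>N\<close> of \<open>\<mu> T\<close> restricted to \<open>D\<close>.\<close>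

lemma integral_restrict:
  assumes T: "T \<subseteq> X" "N \<subseteq> T" and D: "D \<in> sets (powM J T)" and f: "f \<in> borel_measurable (powM J N)"
  shows "(\<integral>\<^sup>+ z\<in>D. f (restrict z N) \<partial>\<mu> T) =
    (\<integral>\<^sup>+ x. f x * emeasure (\<nu> N T x) (slice J N T D x) \<partial>\<mu> N)"
proof -
  have N: "N \<subseteq> X" using T by auto
  define g where "g x = emeasure (\<nu> N T x) (slice J N T D x)" for x
  have g: "g \<in> borel_measurable (\<mu> N)"
    unfolding g_def by (rule borel_mu[OF N nu_slice_measurable[OF T D]])
  have D': "D \<in> sets (\<mu> T)" using D sets_mu[OF T(1)] by simp
  have r: "(\<lambda>z. restrict z N) \<in> measurable (powM J T) (powM J N)"
    using T by (intro measurable_restrict_subset)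
  have r': "(\<lambda>z. restrict z N) \<in> measurable (\<mu> T) (powM J N)"
    using r sets_mu[OF T(1)] by (simp cong: measurable_cong_sets)
  have r'': "(\<lambda>z. restrict z N) \<in> measurable (density (\<mu> T) (indicator D)) (powM J N)"
    using r' measurable_cong_sets[OF sets_density refl] by blast
  have eq: "distr (density (\<mu> T) (indicator D)) (powM J N) (\<lambda>z. restrict z N) = density (\<mu> N) g"
    (is "?L = ?R")
  proof (rule measure_eqI)
    show "sets ?L = sets ?R" using sets_mu[OF N] by simp
    fix C assume "C \<in> sets ?L"
    then have C: "C \<in> sets (powM J N)" by simp
    have C': "C \<in> sets (\<mu> N)" using C sets_mu[OF N] by simp
    let ?C = "(\<lambda>z. restrict z N) -` C \<inter> space (powM J T)"
    have rC: "?C \<in> sets (powM J T)" by (rule measurable_sets[OF r C])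
    have sl: "slice J N T (D \<inter> ?C) x = (if x \<in> C then slice J N T D x else {})"
      if x: "x \<in> space (powM J N)" for x
    proof -
      have "restrict (merge N (T - N) (x, y)) N = x" for y
        using x by (auto simp: space_PiM PiE_def extensional_def merge_def fun_eq_iff)
      moreover have "merge N (T - N) (x, y) \<in> space (powM J T)" if "y \<in> space (powM J (T - N))" for y
        using that x T(2) by (auto simp: space_PiM PiE_def Pi_def extensional_def merge_def)
      ultimately show ?thesis by (auto simp: slice_def)
    qed
    have "emeasure ?L C = emeasure (density (\<mu> T) (indicator D)) ?C"
      using C r' by (simp add: emeasure_distr space_mu[OF T(1)])
    also have "\<dots> = (\<integral>\<^sup>+ z. indicator D z * indicator ?C z \<partial>\<mu> T)"
      using D' rC sets_mu[OF T(1)] by (intro emeasure_density) auto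
    also have "\<dots> = (\<integral>\<^sup>+ z. indicator (D \<inter> ?C) z \<partial>\<mu> T)"
      by (simp add: indicator_inter_arith)
    also have "\<dots> = emeasure (\<mu> T) (D \<inter> ?C)"
      using D' rC sets_mu[OF T(1)] by (intro nn_integral_indicator) auto
    also have "\<dots> = (\<integral>\<^sup>+ x. emeasure (\<nu> N T x) (slice J N T (D \<inter> ?C) x) \<partial>\<mu> N)"
      using T D rC by (intro emeasure_mu) auto
    also have "\<dots> = (\<integral>\<^sup>+ x. g x * indicator C x \<partial>\<mu> N)"
      by (rule nn_integral_cong) (simp add: space_mu[OF N] sl g_def)
    also have "\<dots> = emeasure ?R C"
      using g C' by (simp add: emeasure_density)
    finally show "emeasure ?L C = emeasure ?R C" .
  qed
  have "(\<integral>\<^sup>+ z\<in>D. f (restrict z N) \<partial>\<mu> T) = (\<integral>\<^sup>+ z. indicator D z * f (restrict z N) \<partial>\<mu> T)"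
    by (simp add: mult.commute)
  also have "\<dots> = (\<integral>\<^sup>+ z. f (restrict z N) \<partial>density (\<mu> T) (indicator D))"
    using D' measurable_compose[OF r' f] by (intro nn_integral_density[symmetric]) auto
  also have "\<dots> = (\<integral>\<^sup>+ x. f x \<partial>?L)"
    by (rule nn_integral_distr[OF r'', symmetric]) (use f in simp)
  also have "\<dots> = (\<integral>\<^sup>+ x. g x * f x \<partial>\<mu> N)"
    unfolding eq by (rule nn_integral_density[OF g borel_mu[OF N f]])
  finally show ?thesis by (simp add: g_def mult.commute)
qed

text \<open>Both kernels have the same integrals over all measurable subsets of \<open>J\<^sup>N\<close>. The exceptional null
  set may depend on \<open>A\<close>.\<close>

lemma nu_singleton_AE:
  assumes u: "u \<in> X" "N \<subseteq> X" "u \<notin> N"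
    and K: "conditional_kernel J N u (\<mu> N) (\<mu> (insert u N)) K" and A: "A \<in> sets J"
  shows "AE x in \<mu> N. emeasure (\<nu> N (insert u N) x) {y \<in> space (powM J {u}). y u \<in> A} = emeasure (K x) A"
proof -
  interpret sigma_finite_measure "\<mu> N" by (rule sigma_finite[OF u(2)])
  have T: "insert u N \<subseteq> X" "insert u N - N = {u}" using u by auto
  let ?B = "{y \<in> space (powM J {u}). y u \<in> A}"
  have B: "?B \<in> sets (powM J (insert u N - N))"
    using A unfolding T by measurable
  note d = disintegration_rectangle[OF disint[OF T(1) subset_insertI] subset_insertI sets_mu[OF u(2)] _ B]
  have m1: "(\<lambda>x. emeasure (\<nu> N (insert u N) x) ?B) \<in> borel_measurable (\<mu> N)"
    by (rule borel_mu[OF u(2) d(1)[OF sets.top]])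
  have m2: "(\<lambda>x. emeasure (K x) A) \<in> borel_measurable (\<mu> N)"
    using K A by (intro borel_mu[OF u(2)]) (auto simp: conditional_kernel_def finite_kernel_def)
  show ?thesis
  proof (rule density_unique[OF m1 m2], rule measure_eqI)
    fix D assume D: "D \<in> sets (density (\<mu> N) (\<lambda>x. emeasure (\<nu> N (insert u N) x) ?B))"
    then have D': "D \<in> sets (powM J N)" using sets_mu[OF u(2)] by simp
    have "{z \<in> space (powM J (insert u N)). restrict z N \<in> D \<and> restrict z (insert u N - N) \<in> ?B} =
        {z \<in> space (powM J (insert u N)). restrict z N \<in> D \<and> z u \<in> A}"
      unfolding T(2) by (auto simp: space_PiM)
    then show "emeasure (density (\<mu> N) (\<lambda>x. emeasure (\<nu> N (insert u N) x) ?B)) D =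
        emeasure (density (\<mu> N) (\<lambda>x. emeasure (K x) A)) D"
      using d(2)[OF D'] K A D D' m1 m2 by (simp add: emeasure_density conditional_kernel_def)
  qed simp
qed

text \<open>The Markov property is applied to \<open>T\<close> and \<open>N \<union> {u}\<close>. A slice of the rectangle over \<open>D\<close> and \<open>A\<close> is
  again a rectangle, whose measure under \<open>\<nu> N T x \<times> \<nu> N (N \<union> {u}) x\<close> is a product of two factors.
  The second factor is \<open>K x A\<close> for almost all \<open>x\<close>, and the first integrates to a marginal of
  \<open>\<mu> T\<close>.\<close>

lemma markov_rectangle:
  assumes u: "T \<subseteq> X" "u \<in> X" "u \<notin> T" "N \<subseteq> T" and E: "\<And>t. t \<in> T - N \<Longrightarrow> \<not> E t u"
    and K: "conditional_kernel J N u (\<mu> N) (\<mu> (insert u N)) K"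
    and D: "D \<in> sets (powM J T)" and A: "A \<in> sets J"
  shows "emeasure (\<mu> (insert u T)) {z \<in> space (powM J (insert u T)). restrict z T \<in> D \<and> z u \<in> A} =
    (\<integral>\<^sup>+ z\<in>D. emeasure (K (restrict z N)) A \<partial>\<mu> T)"
proof -
  have N: "N \<subseteq> X" "u \<notin> N" "insert u N \<subseteq> X" "insert u T \<subseteq> X" "N \<subseteq> insert u T" using u by auto
  have Kf: "finite_kernel (powM J N) J K" using K by (simp add: conditional_kernel_def)
  let ?C = "{z \<in> space (powM J (insert u T)). restrict z T \<in> D \<and> z u \<in> A}"
  let ?B = "{y \<in> space (powM J {u}). y u \<in> A}"
  have B: "?B \<in> sets (powM J {u})" using A by measurable
  have C: "?C \<in> sets (powM J (insert u T))"
  proof -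
    have "(\<lambda>z. restrict z T) \<in> measurable (powM J (insert u T)) (powM J T)"
      by (rule measurable_restrict_subset) auto
    moreover have "(\<lambda>z. z u) \<in> measurable (powM J (insert u T)) J"
      by (rule measurable_component_singleton) auto
    ultimately show ?thesis using D A by measurable
  qed
  have sets_eq: "insert u N - N = {u}" "T - N \<union> {u} = insert u T - N" using N by auto
  have "AE x in \<mu> N. \<nu> N (T \<union> insert u N) x =
      prodM J (T - N) (insert u N - N) (\<nu> N T x) (\<nu> N (insert u N) x)"
    using u N E by (intro markov) auto
  then have "AE x in \<mu> N. \<nu> N (insert u T) x = prodM J (T - N) {u} (\<nu> N T x) (\<nu> N (insert u N) x)"
    using u(4) by (simp add: sets_eq Un_absorb2)
  moreover note nu_singleton_AE[OF u(2) N(1,2) K A] nu_singleton_AE[OF u(2) N(1,2) K sets.top] AE_space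
  ultimately have "AE x in \<mu> N. emeasure (\<nu> N (insert u T) x) (slice J N (insert u T) ?C x) =
      emeasure (K x) A * emeasure (\<nu> N T x) (slice J N T D x)"
  proof eventually_elim
    case (elim x)
    then have x: "x \<in> space (powM J N)" by (simp add: space_mu[OF N(1)])
    have s1: "sets (\<nu> N T x) = sets (powM J (T - N))"
      by (rule sets_nu[OF u(1,4) x])
    have s2: "sets (\<nu> N (insert u N) x) = sets (powM J {u})"
      using sets_nu[OF N(3) subset_insertI x] by (simp add: sets_eq)
    note sp = sets_eq_imp_space_eq[OF s1] sets_eq_imp_space_eq[OF s2]
    have "{y \<in> space (powM J {u}). y u \<in> space J} = space (\<nu> N (insert u N) x)"
      unfolding sp by (auto simp: space_PiM)
    then have "emeasure (\<nu> N (insert u N) x) (space (\<nu> N (insert u N) x)) = emeasure (K x) (space J)"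
      using elim(3) by simp
    also have "\<dots> < top"
      using finite_measure.emeasure_finite[OF finite_kernelD(2)[OF Kf x]] by (simp add: less_top)
    finally interpret n2: finite_measure "\<nu> N (insert u N) x"
      by (intro finite_measureI) auto
    have mg: "merge (T - N) {u} \<in> measurable (\<nu> N T x \<Otimes>\<^sub>M \<nu> N (insert u N) x) (powM J (insert u T - N))"
      using measurable_merge[of "T - N" "{u}" "\<lambda>_. J", unfolded sets_eq(2)]
      by (simp add: s1 s2 cong: measurable_cong_sets sets_pair_measure_cong)
    have "merge N (insert u T - N) (x, merge (T - N) {u} (p, q)) \<in> ?C \<longleftrightarrow>
        merge N (T - N) (x, p) \<in> D \<and> q u \<in> A"
      if p: "p \<in> space (powM J (T - N))" and q: "q \<in> space (powM J {u})" for p q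
    proof -
      let ?z = "merge N (insert u T - N) (x, merge (T - N) {u} (p, q))"
      have "restrict ?z T = merge N (T - N) (x, p)"
        using x p u N by (auto simp: space_PiM PiE_def extensional_def merge_def fun_eq_iff)
      moreover have "?z u = q u" using u N by (auto simp: merge_def)
      moreover have "?z \<in> space (powM J (insert u T))"
        using x p q u N by (auto simp: space_PiM PiE_def Pi_def extensional_def merge_def)
      ultimately show ?thesis by auto
    qed
    moreover have "merge (T - N) {u} (p, q) \<in> space (powM J (insert u T - N))"
      if "p \<in> space (powM J (T - N))" "q \<in> space (powM J {u})" for p q
      using that N by (auto simp: space_PiM PiE_def Pi_def extensional_def merge_def)
    ultimately have pre: "merge (T - N) {u} -` slice J N (insert u T) ?C x \<inter>
        space (\<nu> N T x \<Otimes>\<^sub>M \<nu> N (insert u N) x) = slice J N T D x \<times> ?B"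
      by (auto simp: slice_def space_pair_measure sp)
    have "emeasure (\<nu> N (insert u T) x) (slice J N (insert u T) ?C x) =
        emeasure (\<nu> N T x \<Otimes>\<^sub>M \<nu> N (insert u N) x) (slice J N T D x \<times> ?B)"
      unfolding elim(1) prodM_def sets_eq(2)
      using mg slice_measurable[OF C N(5) x] by (subst emeasure_distr) (simp_all only: pre)
    also have "\<dots> = emeasure (\<nu> N T x) (slice J N T D x) * emeasure (\<nu> N (insert u N) x) ?B"
      using slice_measurable[OF D u(4) x] B s1 s2 by (intro n2.emeasure_pair_measure_Times) auto
    finally show ?case using elim(2) by (simp add: mult.commute)
  qed
  then have "(\<integral>\<^sup>+ x. emeasure (\<nu> N (insert u T) x) (slice J N (insert u T) ?C x) \<partial>\<mu> N) =
      (\<integral>\<^sup>+ x. emeasure (K x) A * emeasure (\<nu> N T x) (slice J N T D x) \<partial>\<mu> N)"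
    by (rule nn_integral_cong_AE)
  also have "\<dots> = (\<integral>\<^sup>+ z\<in>D. emeasure (K (restrict z N)) A \<partial>\<mu> T)"
    by (rule integral_restrict[OF u(1,4) D finite_kernelD(3)[OF Kf A], symmetric])
  finally show ?thesis
    using emeasure_mu[OF N(4,5) C] by simp
qed

text \<open>If all neighbours of \<open>u\<close> in \<open>T\<close> lie in \<open>N\<close>, then \<open>\<mu> (T \<union> {u})\<close> arises from \<open>\<mu> T\<close> by placing \<open>u\<close> with any
  conditional kernel of \<open>\<mu> (N \<union> {u})\<close> over \<open>\<mu> N\<close>. The kernel may come from another family, as long as
  the two measures are the same; this is how different families are compared.\<close>

lemma markov_extension:
  assumes ne: "space J \<noteq> {}" and u: "T \<subseteq> X" "u \<in> X" "u \<notin> T" "N \<subseteq> T"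
    and E: "\<And>t. t \<in> T - N \<Longrightarrow> \<not> E t u"
    and K: "conditional_kernel J N u (\<mu> N) (\<mu> (insert u N)) K"
    and f: "f \<in> borel_measurable (powM J (insert u T))"
  shows "(\<integral>\<^sup>+ z. f z \<partial>\<mu> (insert u T)) = (\<integral>\<^sup>+ z. \<integral>\<^sup>+ a. f (z(u := a)) \<partial>K (restrict z N) \<partial>\<mu> T)"
proof -
  let ?Y = "powM J (insert u T)"
  have uT: "insert u T \<subseteq> X" using u by auto
  define K' where "K' z = K (restrict z N)" for z
  have K': "finite_kernel (powM J T) J K'"
    unfolding K'_def using K u(4) by (intro finite_kernel_comp[OF _ measurable_restrict_subset])
      (auto simp: conditional_kernel_def)
  have neT: "space (powM J T) \<noteq> {}" using ne by (simp add: space_PiM PiE_eq_empty_iff)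
  obtain L where L: "sets L = sets ?Y" and Li: "\<And>f. f \<in> borel_measurable ?Y \<Longrightarrow>
       (\<integral>\<^sup>+ z. f z \<partial>L) = (\<integral>\<^sup>+ z. \<integral>\<^sup>+ a. f (z(u := a)) \<partial>K' z \<partial>\<mu> T)"
    by (rule measure_composed_with_kernel[OF K' ne neT sets_mu[OF u(1)] measurable_add_dim]) (rule that)
  have R: "{z \<in> space ?Y. restrict z T \<in> D \<and> z u \<in> A} \<in> sets ?Y"
    if "D \<in> sets (powM J T)" "A \<in> sets J" for D A
  proof -
    have "(\<lambda>z. restrict z T) \<in> measurable ?Y (powM J T)"
      by (rule measurable_restrict_subset) auto
    moreover have "(\<lambda>z. z u) \<in> measurable ?Y J"
      by (rule measurable_component_singleton) auto
    ultimately show ?thesis using that by measurable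
  qed
  have Lr: "emeasure L {z \<in> space ?Y. restrict z T \<in> D \<and> z u \<in> A} = (\<integral>\<^sup>+ z\<in>D. emeasure (K' z) A \<partial>\<mu> T)"
    if D: "D \<in> sets (powM J T)" and A: "A \<in> sets J" for D A
  proof -
    let ?R = "{z \<in> space ?Y. restrict z T \<in> D \<and> z u \<in> A}"
    have "emeasure L ?R = (\<integral>\<^sup>+ z. indicator ?R z \<partial>L)"
      using R[OF that] L by (intro nn_integral_indicator[symmetric]) simp
    also have "\<dots> = (\<integral>\<^sup>+ z. \<integral>\<^sup>+ a. indicator ?R (z(u := a)) \<partial>K' z \<partial>\<mu> T)"
      using R[OF that] by (intro Li) auto
    also have "\<dots> = (\<integral>\<^sup>+ z\<in>D. emeasure (K' z) A \<partial>\<mu> T)"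
    proof (rule nn_integral_cong)
      fix z assume "z \<in> space (\<mu> T)"
      then have z: "z \<in> space (powM J T)" by (simp add: space_mu[OF u(1)])
      have sK: "sets (K' z) = sets J" by (rule finite_kernelD(1)[OF K' z])
      have "z(u := a) \<in> ?R \<longleftrightarrow> z \<in> D \<and> a \<in> A" if "a \<in> space J" for a
      proof -
        have "restrict (z(u := a)) T = z"
          using z u(3) by (auto simp: space_PiM PiE_def extensional_def fun_eq_iff)
        moreover have "z(u := a) \<in> space ?Y"
          using z that by (auto simp: space_PiM PiE_def extensional_def)
        ultimately show ?thesis by simp
      qed
      then have "(\<integral>\<^sup>+ a. indicator ?R (z(u := a)) \<partial>K' z) = (\<integral>\<^sup>+ a. indicator D z * indicator A a \<partial>K' z)"
        using sets_eq_imp_space_eq[OF sK] by (intro nn_integral_cong) (auto simp: indicator_def)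
      also have "\<dots> = indicator D z * (\<integral>\<^sup>+ a. indicator A a \<partial>K' z)"
        using A sK by (intro nn_integral_cmult) auto
      also have "\<dots> = emeasure (K' z) A * indicator D z"
        using A sK by (simp add: mult.commute)
      finally show "(\<integral>\<^sup>+ a. indicator ?R (z(u := a)) \<partial>K' z) = emeasure (K' z) A * indicator D z" .
    qed
    finally show ?thesis .
  qed
  obtain C where C: "range C \<subseteq> sets (\<mu> T)" "(\<Union>i. C i) = space (\<mu> T)"
      "\<And>i. emeasure (\<mu> T) (C i) \<noteq> \<infinity>" "incseq C"
    using sigma_finite_measure.sigma_finite_incseq[OF sigma_finite[OF u(1)]] by metis
  define c where "c z = emeasure (K' z) (space J)" for z
  have c: "c \<in> borel_measurable (powM J T)"
    unfolding c_def by (rule finite_kernelD(3)[OF K' sets.top])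
  (* on C' i the base measure is finite and the mass of the kernel at most i *)
  define C' where "C' i = C i \<inter> {z \<in> space (powM J T). c z \<le> of_nat i}" for i :: nat
  have C': "C' i \<in> sets (powM J T)" for i
    unfolding C'_def using C(1) sets_mu[OF u(1)] c by (intro sets.Int) auto
  have "L = \<mu> (insert u T)"
  proof (rule measure_eqI_rectangles[OF u(3) L sets_mu[OF uT]])
    fix D A assume D: "D \<in> sets (powM J T)" and A: "A \<in> sets J"
    show "emeasure L {z \<in> space ?Y. restrict z T \<in> D \<and> z u \<in> A} =
        emeasure (\<mu> (insert u T)) {z \<in> space ?Y. restrict z T \<in> D \<and> z u \<in> A}"
      using Lr[OF D A] markov_rectangle[OF u E K D A] by (simp add: K'_def)
  next
    show "range C' \<subseteq> sets (powM J T)" using C' by auto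
    show "(\<Union>i. C' i) = space (powM J T)"
    proof (intro equalityI subsetI)
      fix z assume z: "z \<in> space (powM J T)"
      then obtain i where i: "z \<in> C i" using C(2) space_mu[OF u(1)] by auto
      have "c z < top"
        using finite_measure.emeasure_finite[OF finite_kernelD(2)[OF K' z]] by (simp add: c_def less_top)
      then obtain j :: nat where j: "c z \<le> of_nat j"
        using ennreal_Ex_less_of_nat less_imp_le by blast
      have "z \<in> C (max i j)" using i incseqD[OF \<open>incseq C\<close> max.cobounded1] by blast
      moreover have "c z \<le> of_nat (max i j)"
        using j by (rule order_trans) (simp add: of_nat_mono)
      ultimately show "z \<in> (\<Union>i. C' i)" using z by (auto simp: C'_def)
    qed (auto simp: C'_def)
    fix i
    have "{z \<in> space ?Y. restrict z T \<in> C' i} = {z \<in> space ?Y. restrict z T \<in> C' i \<and> z u \<in> space J}"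
      by (auto simp: space_PiM)
    then have "emeasure L {z \<in> space ?Y. restrict z T \<in> C' i} = (\<integral>\<^sup>+ z\<in>C' i. c z \<partial>\<mu> T)"
      using Lr[OF C' sets.top] by (simp add: c_def)
    also have "\<dots> \<le> (\<integral>\<^sup>+ z. of_nat i * indicator (C i) z \<partial>\<mu> T)"
      by (rule nn_integral_mono) (auto simp: C'_def indicator_def)
    also have "\<dots> = of_nat i * emeasure (\<mu> T) (C i)"
      using C(1) by (subst nn_integral_cmult_indicator) auto
    also have "\<dots> < top"
      using C(3)[of i] by (simp add: ennreal_mult_less_top of_nat_less_top less_top)
    finally show "emeasure L {z \<in> space ?Y. restrict z T \<in> C' i} \<noteq> \<infinity>" by simp
  qed
  then show ?thesis using Li[OF f] by (simp add: K'_def)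
qed

end

section \<open>Uniqueness on independent sets and stars\<close>

text \<open>Finiteness of \<open>\<mu> (N \<union> {u})\<close> makes \<open>\<nu> N (N \<union> {u}) x\<close> finite for almost all \<open>x\<close>; at the other points it
  is replaced by the null measure.\<close>

lemma (in markov_family) kernel_exists:
  assumes u: "u \<in> X" "N \<subseteq> X" "u \<notin> N" and fin: "emeasure (\<mu> (insert u N)) (space (powM J (insert u N))) < top"
  shows "\<exists>K. conditional_kernel J N u (\<mu> N) (\<mu> (insert u N)) K"
proof -
  have T: "insert u N \<subseteq> X" "insert u N - N = {u}" using u by auto
  define n where "n x = emeasure (\<nu> N (insert u N) x) (space (powM J {u}))" for x
  define K where "K x = (if n x < top then distr (\<nu> N (insert u N) x) J (\<lambda>y. y u) else null_measure J)" for x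
  note d = disintegration_rectangle[OF disint[OF T(1) subset_insertI] subset_insertI sets_mu[OF u(2)], unfolded T(2)]
  have sn: "sets (\<nu> N (insert u N) x) = sets (powM J {u})" if "x \<in> space (powM J N)" for x
    using sets_nu[OF T(1) subset_insertI that] by (simp add: T(2))
  have n: "n \<in> borel_measurable (powM J N)"
    unfolding n_def by (rule d(1)[OF sets.top sets.top])
  have B: "{y \<in> space (powM J {u}). y u \<in> A} \<in> sets (powM J {u})" if "A \<in> sets J" for A
    using that by measurable
  have KA: "emeasure (K x) A = (if n x < top then emeasure (\<nu> N (insert u N) x) {y \<in> space (powM J {u}). y u \<in> A} else 0)"
    if x: "x \<in> space (powM J N)" and A: "A \<in> sets J" for x A
  proof -
    have m: "(\<lambda>y. y u) \<in> measurable (\<nu> N (insert u N) x) J"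
      by (subst measurable_cong_sets[OF sn[OF x] refl]) (rule measurable_component_singleton, simp)
    have "(\<lambda>y. y u) -` A \<inter> space (\<nu> N (insert u N) x) = {y \<in> space (powM J {u}). y u \<in> A}"
      using sets_eq_imp_space_eq[OF sn[OF x]] by auto
    then show ?thesis by (simp add: K_def emeasure_distr[OF m A])
  qed
  have "finite_kernel (powM J N) J K"
    unfolding finite_kernel_def
  proof (intro conjI ballI)
    fix x assume x: "x \<in> space (powM J N)"
    show "sets (K x) = sets J" by (simp add: K_def)
    have "space (K x) = space J" by (simp add: K_def)
    moreover have "{y \<in> space (powM J {u}). y u \<in> space J} = space (powM J {u})"
      by (auto simp: space_PiM)
    ultimately have "emeasure (K x) (space (K x)) = (if n x < top then n x else 0)"
      using KA[OF x sets.top] by (simp add: n_def)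
    then show "finite_measure (K x)"
      by (intro finite_measureI) (auto split: if_splits)
  next
    fix A assume A: "A \<in> sets J"
    have "(\<lambda>x. if n x < top then emeasure (\<nu> N (insert u N) x) {y \<in> space (powM J {u}). y u \<in> A} else 0)
        \<in> borel_measurable (powM J N)"
      using n d(1)[OF sets.top B[OF A]] by measurable
    then show "(\<lambda>x. emeasure (K x) A) \<in> borel_measurable (powM J N)"
      by (rule measurable_cong[THEN iffD1, rotated]) (simp add: KA[OF _ A])
  qed
  moreover have "emeasure (\<mu> (insert u N)) {z \<in> space (powM J (insert u N)). restrict z N \<in> D \<and> z u \<in> A} =
        (\<integral>\<^sup>+ x\<in>D. emeasure (K x) A \<partial>\<mu> N)"
    if D: "D \<in> sets (powM J N)" and A: "A \<in> sets J" for D A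
  proof -
    have "(\<integral>\<^sup>+ x. n x * indicator (space (powM J N)) x \<partial>\<mu> N) = emeasure (\<mu> (insert u N))
        {z \<in> space (powM J (insert u N)). restrict z N \<in> space (powM J N) \<and> restrict z {u} \<in> space (powM J {u})}"
      unfolding n_def by (rule d(2)[OF sets.top sets.top, symmetric])
    also have "{z \<in> space (powM J (insert u N)). restrict z N \<in> space (powM J N) \<and> restrict z {u} \<in> space (powM J {u})}
        = space (powM J (insert u N))"
      by (auto simp: space_PiM)
    finally have "(\<integral>\<^sup>+ x. n x * indicator (space (powM J N)) x \<partial>\<mu> N) \<noteq> \<infinity>" using fin by simp
    then have "AE x in \<mu> N. n x * indicator (space (powM J N)) x \<noteq> \<infinity>"
      using n by (intro nn_integral_PInf_AE borel_mu[OF u(2)]) auto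
    then have ae: "AE x in \<mu> N. emeasure (\<nu> N (insert u N) x) {y \<in> space (powM J {u}). y u \<in> A} * indicator D x =
        emeasure (K x) A * indicator D x"
      using AE_space by eventually_elim (simp add: KA A space_mu[OF u(2)] less_top)
    have "{z \<in> space (powM J (insert u N)). restrict z N \<in> D \<and> z u \<in> A} =
      {z \<in> space (powM J (insert u N)). restrict z N \<in> D \<and> restrict z {u} \<in> {y \<in> space (powM J {u}). y u \<in> A}}"
      by (auto simp: space_PiM)
    then show ?thesis
      using d(2)[OF D B[OF A]] nn_integral_cong_AE[OF ae] by simp
  qed
  ultimately show ?thesis unfolding conditional_kernel_def by blast
qed

text \<open>If \<open>P\<close> is the marginal of \<open>Q\<close>, then the kernel has the same integrals as the constant \<open>1\<close>.\<close>

lemma conditional_kernel_mass: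
  assumes K: "conditional_kernel J N u P Q K" and P: "sets P = sets (powM J N)" "sigma_finite_measure P"
    and marg: "\<And>D. D \<in> sets (powM J N) \<Longrightarrow>
      emeasure Q {z \<in> space (powM J (insert u N)). restrict z N \<in> D} = emeasure P D"
  shows "AE x in P. emeasure (K x) (space J) = 1"
proof -
  interpret sigma_finite_measure P by fact
  have m: "(\<lambda>x. emeasure (K x) (space J)) \<in> borel_measurable P"
    using K P(1) by (auto simp: conditional_kernel_def finite_kernel_def cong: measurable_cong_sets)
  have "density P (\<lambda>x. emeasure (K x) (space J)) = density P (\<lambda>_. 1)"
  proof (rule measure_eqI)
    fix D assume "D \<in> sets (density P (\<lambda>x. emeasure (K x) (space J)))"
    then have D: "D \<in> sets P" "D \<in> sets (powM J N)" using P(1) by auto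
    have "{z \<in> space (powM J (insert u N)). restrict z N \<in> D \<and> z u \<in> space J} =
        {z \<in> space (powM J (insert u N)). restrict z N \<in> D}"
      by (auto simp: space_PiM)
    moreover have "emeasure Q {z \<in> space (powM J (insert u N)). restrict z N \<in> D \<and> z u \<in> space J} =
        (\<integral>\<^sup>+ x\<in>D. emeasure (K x) (space J) \<partial>P)"
      using K D(2) by (simp add: conditional_kernel_def)
    ultimately show "emeasure (density P (\<lambda>x. emeasure (K x) (space J))) D = emeasure (density P (\<lambda>_. 1)) D"
      using D m marg[OF D(2)] by (simp add: emeasure_density)
  qed simp
  from density_unique[OF m _ this] show ?thesis by simp
qed

locale edge_measure =
  fixes J :: "'a measure" and \<eta> :: "('a \<times> 'a) measure"
  assumes prob: "prob_space \<eta>" and sets_eta: "sets \<eta> = sets (J \<Otimes>\<^sub>M J)"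

sublocale edge_measure \<subseteq> prob_space \<eta> by (rule prob)

context edge_measure
begin

lemma space_eta: "space \<eta> = space J \<times> space J"
  using sets_eq_imp_space_eq[OF sets_eta] by (simp add: space_pair_measure)

lemma space_J_ne: "space J \<noteq> {}"
  using not_empty by (auto simp: space_eta)

lemma fst_eta: "fst \<in> measurable \<eta> J"
  by (subst measurable_cong_sets[OF sets_eta refl]) simp

lemma sets_marginal: "sets (marginal J \<eta>) = sets J"
  by (simp add: marginal_def)

lemma prob_marginal: "prob_space (marginal J \<eta>)"
  unfolding marginal_def by (rule prob_space_distr[OF fst_eta])

lemma vertex_map: "(\<lambda>a. \<lambda>k\<in>{i}. a) \<in> measurable J (powM J {i})"
  by (intro measurable_restrict) simp

lemma edge_map:
  "(\<lambda>(a, b). \<lambda>k\<in>{i, j}. if k = i then a else b) \<in> measurable \<eta> (powM J {i, j})"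
  unfolding split_beta'
  by (subst measurable_cong_sets[OF sets_eta refl], intro measurable_restrict) auto

end

locale edge_markov_family = edge_measure J \<eta> + markov_family J \<eta> E X \<mu> \<nu>
  for J :: "'a measure" and \<eta> and E :: "'v \<Rightarrow> 'v \<Rightarrow> bool" and X \<mu> \<nu>
begin

lemma marginal_kernel:
  assumes "u \<in> X"
  shows "conditional_kernel J {} u (\<mu> {}) (\<mu> (insert u {})) (\<lambda>_. marginal J \<eta>)"
  unfolding conditional_kernel_def finite_kernel_def
proof (intro conjI ballI)
  interpret m: prob_space "marginal J \<eta>" by (rule prob_marginal)
  show "finite_measure (marginal J \<eta>)" by (rule m.finite_measure_axioms)
  fix D :: "('v \<Rightarrow> 'a) set" and A assume D: "D \<in> sets (powM J {})" and A: "A \<in> sets J"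
  let ?C = "{z \<in> space (powM J {u}). restrict z {} \<in> D \<and> z u \<in> A}"
  have "?C = (if (\<lambda>_. undefined) \<in> D then {z \<in> space (powM J {u}). z u \<in> A} else {})"
    by (auto simp: restrict_def)
  moreover have "{z \<in> space (powM J {u}). z u \<in> A} \<in> sets (powM J {u})"
    using A by measurable
  ultimately have C: "?C \<in> sets (powM J {u})" by simp
  have vm: "(\<lambda>a. \<lambda>k\<in>{u}. a) \<in> measurable (marginal J \<eta>) (powM J {u})"
    by (subst measurable_cong_sets[OF sets_marginal refl]) (rule vertex_map)
  have sp: "space (marginal J \<eta>) = space J" by (rule sets_eq_imp_space_eq[OF sets_marginal])
  have "(\<lambda>a. \<lambda>k\<in>{u}. a) -` ?C \<inter> space (marginal J \<eta>) = (if (\<lambda>_. undefined) \<in> D then A else {})"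
    using sets.sets_into_space[OF A] by (auto simp: sp space_PiM restrict_def PiE_def extensional_def split: if_splits)
  then have "emeasure (\<mu> {u}) ?C = emeasure (marginal J \<eta>) (if (\<lambda>_. undefined) \<in> D then A else {})"
    unfolding vertex[OF assms] emeasure_distr[OF vm C] by simp
  moreover have "(\<integral>\<^sup>+ x\<in>D. emeasure (marginal J \<eta>) A \<partial>\<mu> {}) =
      emeasure (marginal J \<eta>) A * indicator D (\<lambda>_. undefined)"
    unfolding empty using D by (subst nn_integral_return) (auto simp: space_PiM)
  ultimately show "emeasure (\<mu> {u}) ?C = (\<integral>\<^sup>+ x\<in>D. emeasure (marginal J \<eta>) A \<partial>\<mu> {})"
    by simp
qed (auto simp: sets_marginal)

lemma mass_vertex: "u \<in> X \<Longrightarrow> emeasure (\<mu> {u}) (space (powM J {u})) = 1"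
proof -
  assume u: "u \<in> X"
  interpret m: prob_space "marginal J \<eta>" by (rule prob_marginal)
  have vm: "(\<lambda>a. \<lambda>k\<in>{u}. a) \<in> measurable (marginal J \<eta>) (powM J {u})"
    by (subst measurable_cong_sets[OF sets_marginal refl]) (rule vertex_map)
  show ?thesis
    unfolding vertex[OF u] using prob_space.emeasure_space_1[OF m.prob_space_distr[OF vm]] by simp
qed

text \<open>Every edge occurs in both orientations, and the one that starts in \<open>c\<close> makes the first coordinate of
  \<open>\<eta>\<close> the position of \<open>c\<close>.\<close>

lemma edge_marginal:
  assumes "c \<in> X" "u \<in> X" "E c u" "c \<noteq> u" and D: "D \<in> sets (powM J {c})"
  shows "emeasure (\<mu> (insert u {c})) {z \<in> space (powM J (insert u {c})). restrict z {c} \<in> D} = emeasure (\<mu> {c}) D"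
proof -
  have vm: "(\<lambda>a. \<lambda>k\<in>{c}. a) \<in> measurable (marginal J \<eta>) (powM J {c})"
    by (subst measurable_cong_sets[OF sets_marginal refl]) (rule vertex_map)
  let ?C = "{z \<in> space (powM J {c, u}). restrict z {c} \<in> D}"
  have "(\<lambda>z. restrict z {c}) \<in> measurable (powM J {c, u}) (powM J {c})"
    by (rule measurable_restrict_subset) auto
  from measurable_sets[OF this D] have C_sets: "?C \<in> sets (powM J {c, u})"
    by (simp add: vimage_def Int_def conj_commute)
  have sp: "space (marginal J \<eta>) = space J" by (rule sets_eq_imp_space_eq[OF sets_marginal])
  let ?A = "(\<lambda>a. \<lambda>k\<in>{c}. a) -` D \<inter> space J"
  have A: "?A \<in> sets J" by (rule measurable_sets[OF vertex_map D])
  define C where "C = ?C"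
  have "(\<lambda>k\<in>{c, u}. if k = c then a else b) \<in> C \<longleftrightarrow> (\<lambda>k\<in>{c}. a) \<in> D"
    if "a \<in> space J" "b \<in> space J" for a b
  proof -
    have "restrict (\<lambda>k\<in>{c, u}. if k = c then a else b) {c} = (\<lambda>k\<in>{c}. a)"
      by (auto simp: fun_eq_iff)
    moreover have "(\<lambda>k\<in>{c, u}. if k = c then a else b) \<in> space (powM J {c, u})"
      using that unfolding space_PiM by (intro restrict_PiE_iff[THEN iffD2]) auto
    ultimately show ?thesis by (simp only: C_def mem_Collect_eq simp_thms)
  qed
  then have "(\<lambda>(a, b). \<lambda>k\<in>{c, u}. if k = c then a else b) -` C \<inter> space \<eta> = fst -` ?A \<inter> space \<eta>"
    unfolding space_eta by auto
  then have "emeasure (\<mu> {c, u}) ?C = emeasure \<eta> (fst -` ?A \<inter> space \<eta>)"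
    unfolding edge[OF assms(1-3)] emeasure_distr[OF edge_map C_sets] by (simp only: C_def)
  also have "\<dots> = emeasure (marginal J \<eta>) ?A"
    unfolding marginal_def by (rule emeasure_distr[OF fst_eta A, symmetric])
  also have "\<dots> = emeasure (\<mu> {c}) D"
    unfolding vertex[OF assms(1)] emeasure_distr[OF vm D] by (simp add: sp)
  finally show ?thesis by (simp add: insert_commute)
qed

lemma mass_edge:
  assumes "c \<in> X" "u \<in> X" "E c u" "c \<noteq> u"
  shows "emeasure (\<mu> (insert u {c})) (space (powM J (insert u {c}))) = 1"
proof -
  have "{z \<in> space (powM J (insert u {c})). restrict z {c} \<in> space (powM J {c})} = space (powM J (insert u {c}))"
    by (auto simp: space_PiM)
  then show ?thesis
    using edge_marginal[OF assms sets.top] mass_vertex[OF assms(1)] by simp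
qed

lemma edge_kernel:
  assumes "c \<in> X" "u \<in> X" "E c u" "c \<noteq> u"
  shows "\<exists>K. conditional_kernel J {c} u (\<mu> {c}) (\<mu> (insert u {c})) K"
  using assms by (intro kernel_exists) (auto simp: mass_edge)

end

locale two_markov_families =
  first: edge_markov_family J \<eta> E X \<mu> \<nu> + second: edge_markov_family J \<eta> E X' \<mu>' \<nu>'
  for J :: "'a measure" and \<eta> and E :: "'v \<Rightarrow> 'v \<Rightarrow> bool" and X \<mu> \<nu> X' \<mu>' \<nu>'
begin

lemma extension_unique:
  assumes u: "T \<subseteq> X \<inter> X'" "u \<in> X \<inter> X'" "u \<notin> T" "N \<subseteq> T" "\<And>t. t \<in> T - N \<Longrightarrow> \<not> E t u"
    and eq: "\<mu> T = \<mu>' T" "\<mu> N = \<mu>' N" "\<mu> (insert u N) = \<mu>' (insert u N)"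
    and K: "conditional_kernel J N u (\<mu> N) (\<mu> (insert u N)) K"
  shows "\<mu> (insert u T) = \<mu>' (insert u T)"
proof -
  have K': "conditional_kernel J N u (\<mu>' N) (\<mu>' (insert u N)) K" using K eq by simp
  have s: "sets (\<mu> (insert u T)) = sets (powM J (insert u T))" "sets (\<mu>' (insert u T)) = sets (powM J (insert u T))"
    using first.sets_mu[of "insert u T"] second.sets_mu[of "insert u T"] u(1,2) by auto
  have "(\<integral>\<^sup>+ z. f z \<partial>\<mu> (insert u T)) = (\<integral>\<^sup>+ z. f z \<partial>\<mu>' (insert u T))"
    if f: "f \<in> borel_measurable (powM J (insert u T))" for f
    using first.markov_extension[OF first.space_J_ne _ _ u(3-5) K f]
      second.markov_extension[OF first.space_J_ne _ _ u(3-5) K' f] u(1,2) eq by auto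
  then have "(\<integral>\<^sup>+ z. indicator C z \<partial>\<mu> (insert u T)) = (\<integral>\<^sup>+ z. indicator C z \<partial>\<mu>' (insert u T))"
    if "C \<in> sets (powM J (insert u T))" for C
    using that by auto
  then show ?thesis
    using s by (intro measure_eqI) auto
qed

text \<open>Adding the vertices one by one with no neighbour to look at: the kernel is the marginal of \<open>\<eta>\<close>, so
  both measures are powers of it.\<close>

lemma independent_set_unique:
  assumes "finite T" "T \<subseteq> X \<inter> X'" "\<And>a b. a \<in> T \<Longrightarrow> b \<in> T \<Longrightarrow> \<not> E a b"
  shows "\<mu> T = \<mu>' T"
  using assms
proof (induction T rule: finite_induct)
  case empty
  show ?case by (simp only: first.empty second.empty)
next
  case (insert u T)
  show ?case
  proof (rule extension_unique[where N = "{}"])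
    show "\<mu> (insert u {}) = \<mu>' (insert u {})"
      using insert.prems by (simp add: first.vertex second.vertex)
    show "\<mu> {} = \<mu>' {}" by (simp only: first.empty second.empty)
    show "conditional_kernel J {} u (\<mu> {}) (\<mu> (insert u {})) (\<lambda>_. marginal J \<eta>)"
      using insert.prems by (intro first.marginal_kernel) auto
  qed (use insert in auto)
qed

text \<open>Adding the leaves one by one: each leaf sees only the centre, so its kernel is the conditional law
  of \<open>\<eta>\<close> given one end of the edge, and has mass \<open>1\<close> almost everywhere.\<close>

lemma star_unique:
  assumes "finite L" "insert c L \<subseteq> X \<inter> X'" "c \<notin> L" "\<And>a b. a \<in> L \<Longrightarrow> b \<in> L \<Longrightarrow> \<not> E a b"
    and "\<And>a. a \<in> L \<Longrightarrow> E c a"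
  shows "\<mu> (insert c L) = \<mu>' (insert c L) \<and> emeasure (\<mu> (insert c L)) (space (powM J (insert c L))) = 1"
  using assms
proof (induction L rule: finite_induct)
  case empty
  then show ?case
    using first.vertex[of c] second.vertex[of c] first.mass_vertex[of c] by simp
next
  case (insert u L)
  let ?T = "insert c L"
  have c: "c \<in> X" "u \<in> X" "E c u" "c \<noteq> u" "c \<in> X'" "u \<in> X'" using insert.prems by auto
  have T: "?T \<subseteq> X" "insert u ?T \<subseteq> X" "u \<notin> ?T" using insert.prems insert.hyps by auto
  have IH: "\<mu> ?T = \<mu>' ?T" "emeasure (\<mu> ?T) (space (powM J ?T)) = 1"
    using insert.IH insert.prems by auto
  obtain K where K: "conditional_kernel J {c} u (\<mu> {c}) (\<mu> (insert u {c})) K"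
    using first.edge_kernel[OF c(1-4)] by blast
  have nE: "\<not> E t u" if "t \<in> ?T - {c}" for t using that insert.prems by auto
  have "\<mu> (insert u ?T) = \<mu>' (insert u ?T)"
  proof (rule extension_unique[OF _ _ T(3) _ nE IH(1) _ _ K])
    show "\<mu> (insert u {c}) = \<mu>' (insert u {c})"
      using first.edge[OF c(1-3)] second.edge[OF c(5,6,3)] by (simp add: insert_commute)
    show "\<mu> {c} = \<mu>' {c}" using c by (simp add: first.vertex second.vertex)
  qed (use insert.prems in auto)
  moreover have "emeasure (\<mu> (insert u ?T)) (space (powM J (insert u ?T))) = 1"
  proof -
    have ae: "AE x in \<mu> {c}. emeasure (K x) (space J) = 1"
      using c by (intro conditional_kernel_mass[OF K] first.sets_mu first.sigma_finite first.edge_marginal) auto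
    have "{z \<in> space (powM J (insert u ?T)). restrict z ?T \<in> space (powM J ?T) \<and> z u \<in> space J}
        = space (powM J (insert u ?T))"
      by (auto simp: space_PiM)
    then have "emeasure (\<mu> (insert u ?T)) (space (powM J (insert u ?T))) =
        (\<integral>\<^sup>+ z\<in>space (powM J ?T). emeasure (K (restrict z {c})) (space J) \<partial>\<mu> ?T)"
      using first.markov_rectangle[OF T(1) c(2) T(3) _ nE K sets.top sets.top] by simp
    also have "\<dots> = (\<integral>\<^sup>+ x. emeasure (K x) (space J) *
        emeasure (\<nu> {c} ?T x) (slice J {c} ?T (space (powM J ?T)) x) \<partial>\<mu> {c})"
      using K by (intro first.integral_restrict T) (auto simp: conditional_kernel_def finite_kernel_def)
    also have "\<dots> = (\<integral>\<^sup>+ x. emeasure (\<nu> {c} ?T x) (slice J {c} ?T (space (powM J ?T)) x) \<partial>\<mu> {c})"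
      by (rule nn_integral_cong_AE) (use ae in \<open>eventually_elim, simp\<close>)
    also have "\<dots> = emeasure (\<mu> ?T) (space (powM J ?T))"
      by (rule first.emeasure_mu[OF T(1), symmetric]) auto
    finally show ?thesis using IH(2) by simp
  qed
  ultimately show ?case by (simp add: insert_commute)
qed

end

section \<open>Independence of the order\<close>

text \<open>The hypotheses of the theorem, with the complete bipartite subgraphs given by their colour
  classes \<open>A\<close> and \<open>B\<close>. As there are no triangles, such a subgraph is induced.\<close>

locale complete_bipartite_measured = edge_measure J \<eta>
  for J :: "'a measure" and \<eta> +
  fixes E :: "'v \<Rightarrow> 'v \<Rightarrow> bool" and V :: "'v set"
  assumes finite_V: "finite V"
    and adj_sym: "E u v \<Longrightarrow> E v u"
    and adj_irrefl: "\<not> E v v"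
    and no_triangle: "E u v \<Longrightarrow> E v w \<Longrightarrow> E w u \<Longrightarrow> False"
    and bipartite_family: "A \<noteq> {} \<Longrightarrow> B \<noteq> {} \<Longrightarrow> A \<inter> B = {} \<Longrightarrow> A \<union> B \<subseteq> V \<Longrightarrow>
      (\<And>a b. a \<in> A \<Longrightarrow> b \<in> B \<Longrightarrow> E a b) \<Longrightarrow>
      (\<And>a a'. a \<in> A \<Longrightarrow> a' \<in> A \<Longrightarrow> \<not> E a a') \<Longrightarrow>
      (\<And>b b'. b \<in> B \<Longrightarrow> b' \<in> B \<Longrightarrow> \<not> E b b') \<Longrightarrow>
      \<exists>\<mu> \<nu>. markov_family J \<eta> E (A \<union> B) \<mu> \<nu>"
begin

text \<open>The neighbours of \<open>v\<close> are pairwise non-adjacent, so \<open>v\<close> and \<open>N\<close> span a star. Its family provides a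
  kernel, and by uniqueness on stars and on independent sets this kernel serves all families at once.\<close>

lemma canonical_kernel_exists:
  assumes v: "v \<in> V" "N \<subseteq> V" "N \<noteq> {}" and N: "\<And>u. u \<in> N \<Longrightarrow> E v u"
  shows "\<exists>K. finite_kernel (powM J N) J K \<and>
    (\<forall>X \<mu> \<nu>. markov_family J \<eta> E X \<mu> \<nu> \<longrightarrow> insert v N \<subseteq> X \<longrightarrow>
       conditional_kernel J N v (\<mu> N) (\<mu> (insert v N)) K)"
proof -
  have vN: "v \<notin> N" using N adj_irrefl by blast
  have finN: "finite N" using v(2) finite_V finite_subset by blast
  have indep: "\<not> E a b" if "a \<in> N" "b \<in> N" for a b
    using no_triangle[OF N[OF that(1)], of b] N[OF that(2)] adj_sym by blast
  have "\<exists>\<mu> \<nu>. markov_family J \<eta> E ({v} \<union> N) \<mu> \<nu>"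
    using v vN N indep adj_irrefl by (intro bipartite_family) auto
  then obtain \<mu>0 \<nu>0 where fam0: "markov_family J \<eta> E (insert v N) \<mu>0 \<nu>0" by auto
  interpret f0: edge_markov_family J \<eta> E "insert v N" \<mu>0 \<nu>0
    using edge_measure_axioms fam0 by (rule edge_markov_family.intro)
  interpret f00: two_markov_families J \<eta> E "insert v N" \<mu>0 \<nu>0 "insert v N" \<mu>0 \<nu>0 ..
  have "emeasure (\<mu>0 (insert v N)) (space (powM J (insert v N))) = 1"
    using f00.star_unique[OF finN _ vN indep N] by simp
  then obtain K where K: "conditional_kernel J N v (\<mu>0 N) (\<mu>0 (insert v N)) K"
    using f0.kernel_exists[of v N] vN by auto
  have "conditional_kernel J N v (\<mu> N) (\<mu> (insert v N)) K"
    if fam: "markov_family J \<eta> E X \<mu> \<nu>" and X: "insert v N \<subseteq> X" for X \<mu> \<nu>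
  proof -
    interpret f: edge_markov_family J \<eta> E X \<mu> \<nu>
      using edge_measure_axioms fam by (rule edge_markov_family.intro)
    interpret ff: two_markov_families J \<eta> E "insert v N" \<mu>0 \<nu>0 X \<mu> \<nu> ..
    have "\<mu>0 N = \<mu> N"
      using X by (intro ff.independent_set_unique finN indep) auto
    moreover have "\<mu>0 (insert v N) = \<mu> (insert v N)"
      using ff.star_unique[OF finN _ vN indep N] X by auto
    ultimately show ?thesis using K by simp
  qed
  then show ?thesis using K unfolding conditional_kernel_def by blast
qed

text \<open>A vertex without placed neighbours follows the marginal of \<open>\<eta>\<close>. This case is stated explicitly because
  an isolated vertex lies in no complete bipartite subgraph.\<close>

definition canonical_kernel :: "'v \<Rightarrow> 'v set \<Rightarrow> ('v \<Rightarrow> 'a) \<Rightarrow> 'a measure" where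
  "canonical_kernel v N = (if N = {} then (\<lambda>_. marginal J \<eta>) else
     (SOME K. finite_kernel (powM J N) J K \<and>
       (\<forall>X \<mu> \<nu>. markov_family J \<eta> E X \<mu> \<nu> \<longrightarrow> insert v N \<subseteq> X \<longrightarrow>
          conditional_kernel J N v (\<mu> N) (\<mu> (insert v N)) K)))"

lemma
  assumes v: "v \<in> V" "N \<subseteq> V" and N: "\<And>u. u \<in> N \<Longrightarrow> E v u"
  shows canonical_kernel_finite: "finite_kernel (powM J N) J (canonical_kernel v N)"
    and canonical_kernel_conditional:
      "markov_family J \<eta> E X \<mu> \<nu> \<Longrightarrow> insert v N \<subseteq> X \<Longrightarrow>
       conditional_kernel J N v (\<mu> N) (\<mu> (insert v N)) (canonical_kernel v N)"
proof -
  have "finite_kernel (powM J N) J (canonical_kernel v N) \<and>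
       (\<forall>X \<mu> \<nu>. markov_family J \<eta> E X \<mu> \<nu> \<longrightarrow> insert v N \<subseteq> X \<longrightarrow>
          conditional_kernel J N v (\<mu> N) (\<mu> (insert v N)) (canonical_kernel v N))"
  proof (cases "N = {}")
    case True
    have "finite_kernel (powM J {}) J (\<lambda>_. marginal J \<eta>)"
      unfolding finite_kernel_def
      using prob_space.finite_measure[OF prob_marginal] by (simp add: sets_marginal)
    moreover have "conditional_kernel J {} v (\<mu> {}) (\<mu> (insert v {})) (\<lambda>_. marginal J \<eta>)"
      if fam: "markov_family J \<eta> E X \<mu> \<nu>" and X: "insert v {} \<subseteq> X" for X \<mu> \<nu>
    proof -
      interpret f: edge_markov_family J \<eta> E X \<mu> \<nu>
        using edge_measure_axioms fam by (rule edge_markov_family.intro)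
      show ?thesis using X by (intro f.marginal_kernel) auto
    qed
    ultimately show ?thesis using True by (auto simp: canonical_kernel_def)
  next
    case False
    show ?thesis
      unfolding canonical_kernel_def if_not_P[OF False]
      by (rule someI_ex[OF canonical_kernel_exists[OF v False N]])
  qed
  then show "finite_kernel (powM J N) J (canonical_kernel v N)"
    "markov_family J \<eta> E X \<mu> \<nu> \<Longrightarrow> insert v N \<subseteq> X \<Longrightarrow>
       conditional_kernel J N v (\<mu> N) (\<mu> (insert v N)) (canonical_kernel v N)"
    by auto
qed

sublocale kernel_system J V E canonical_kernel
  by unfold_locales (use space_J_ne adj_sym canonical_kernel_finite in auto)

abbreviation origin :: "'v \<Rightarrow> 'a" where "origin \<equiv> \<lambda>_. undefined"

lemma origin_space: "origin \<in> space (powM J {})"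
  by (simp add: space_PiM)

text \<open>Every given family is built up by the canonical kernels, in any order of its vertices.\<close>

lemma family_integral:
  assumes fam: "markov_family J \<eta> E X \<mu> \<nu>" and X: "X \<subseteq> V"
    and vs: "distinct vs" "set vs \<subseteq> X" and f: "f \<in> borel_measurable (powM J (set vs))"
  shows "(\<integral>\<^sup>+ z. f z \<partial>\<mu> (set vs)) = iter {} vs f origin"
  using vs f
proof (induction vs arbitrary: f rule: rev_induct)
  case Nil
  interpret markov_family J \<eta> E X \<mu> \<nu> by fact
  show ?case using Nil by (simp add: empty nn_integral_return[OF origin_space])
next
  case (snoc v vs)
  interpret markov_family J \<eta> E X \<mu> \<nu> by fact
  let ?T = "set vs"
  let ?N = "nbrs v ?T"
  have T: "?T \<subseteq> X" "v \<in> X" "v \<notin> ?T" "?N \<subseteq> ?T" "?T \<subseteq> V" "v \<in> V"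
    using snoc.prems X nbrs_subset by auto
  have f: "f \<in> borel_measurable (powM J (insert v ?T))" using snoc.prems by simp
  have nE: "\<not> E t v" if "t \<in> ?T - ?N" for t
    using that adj_sym by (auto simp: nbrs_def)
  have K: "conditional_kernel J ?N v (\<mu> ?N) (\<mu> (insert v ?N)) (canonical_kernel v ?N)"
    using T fam by (intro canonical_kernel_conditional) (auto simp: nbrs_def)
  have "(\<integral>\<^sup>+ z. f z \<partial>\<mu> (insert v ?T)) = (\<integral>\<^sup>+ z. iter ?T [v] f z \<partial>\<mu> ?T)"
    using markov_extension[OF space_J_ne T(1-4) nE K f] by (simp add: step_def)
  also have "\<dots> = iter {} vs (iter ?T [v] f) origin"
    using snoc.prems f T by (intro snoc.IH iter_measurable) auto
  also have "\<dots> = iter {} (vs @ [v]) f origin"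
    by (simp only: iter_append Un_empty_left)
  finally show ?case by simp
qed

text \<open>The heart of the proof, by induction on \<open>T\<close>. By the induction hypothesis the order of all but the
  last vertex is irrelevant, and two non-adjacent vertices can exchange the last place. Hence the last
  vertex may be any vertex, unless the complement of the graph on \<open>T\<close> is disconnected. In that case
  \<open>T\<close> splits into two nonempty parts \<open>A\<close> and \<open>B\<close> with all edges between them. An edge inside one part
  would form a triangle with a vertex of the other part, so \<open>T\<close> is complete bipartite, and its given
  family determines the integral in every order.\<close>

lemma order_independent:
  assumes "T \<subseteq> V" "distinct vs" "distinct ws" "set vs = T" "set ws = T"
    and "f \<in> borel_measurable (powM J T)"
  shows "iter {} vs f origin = iter {} ws f origin"
proof -
  have "finite T" using assms(1) finite_V finite_subset by blast
  then show ?thesis using assms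
  proof (induction T arbitrary: vs ws f rule: finite_psubset_induct)
    case (psubset T)
    (* the orders of T that end in a yield the same integrals as those that end in b *)
    define agree where "agree a b \<longleftrightarrow> (\<forall>vs ws. \<forall>f\<in>borel_measurable (powM J T).
      distinct (vs @ [a]) \<longrightarrow> distinct (ws @ [b]) \<longrightarrow> set (vs @ [a]) = T \<longrightarrow> set (ws @ [b]) = T \<longrightarrow>
      iter {} (vs @ [a]) f origin = iter {} (ws @ [b]) f origin)" for a b
    have agreeD: "iter {} (vs @ [a]) f origin = iter {} (ws @ [b]) f origin"
      if "agree a b" "f \<in> borel_measurable (powM J T)" "distinct (vs @ [a])" "distinct (ws @ [b])"
        "set (vs @ [a]) = T" "set (ws @ [b]) = T" for a b vs ws and f :: "('v \<Rightarrow> 'a) \<Rightarrow> ennreal"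
      using that unfolding agree_def by blast
    have list: "\<exists>l. distinct l \<and> set l = T'" if "T' \<subseteq> T" for T'
      using finite_distinct_list[of T'] finite_subset[OF that psubset.hyps] by auto
    have refl: "agree a a" for a
      unfolding agree_def
    proof (intro allI ballI impI)
      fix vs ws :: "'v list" and f :: "('v \<Rightarrow> 'a) \<Rightarrow> ennreal" assume f: "f \<in> borel_measurable (powM J T)"
        and l: "distinct (vs @ [a])" "distinct (ws @ [a])" "set (vs @ [a]) = T" "set (ws @ [a]) = T"
      have sub: "T - {a} \<subset> T" and s: "set vs = T - {a}" "set ws = T - {a}" using l by auto
      have m: "iter (T - {a}) [a] f \<in> borel_measurable (powM J (T - {a}))"
        using l psubset.prems(1) f by (intro iter_measurable) (auto simp: insert_absorb)
      have "iter {} vs (iter (T - {a}) [a] f) origin = iter {} ws (iter (T - {a}) [a] f) origin"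
        by (rule psubset.IH[OF sub _ _ _ s m]) (use l psubset.prems(1) in auto)
      then show "iter {} (vs @ [a]) f origin = iter {} (ws @ [a]) f origin"
        by (simp only: iter_append s Un_empty_left)
    qed
    have sym: "agree b a" if "agree a b" for a b
      using agreeD[OF that] unfolding agree_def by metis
    have trans: "agree a c" if "agree a b" "agree b c" "b \<in> T" for a b c
    proof -
      obtain l where l: "distinct l" "set l = T - {b}" using list[of "T - {b}"] by auto
      then have "distinct (l @ [b])" "set (l @ [b]) = T" using that(3) by auto
      then show ?thesis
        using agreeD[OF that(1)] agreeD[OF that(2)] unfolding agree_def by metis
    qed
    have nonadjacent: "agree a b" if ab: "a \<in> T" "b \<in> T" "\<not> E a b" for a b
    proof (cases "a = b")
      case True
      then show ?thesis using refl by simp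
    next
      case False
      obtain l where l: "distinct l" "set l = T - {a, b}" using list[of "T - {a, b}"] by auto
      have l': "distinct ((l @ [b]) @ [a])" "set ((l @ [b]) @ [a]) = T"
          "distinct ((l @ [a]) @ [b])" "set ((l @ [a]) @ [b]) = T"
        using l ab False by auto
      have swap: "iter {} ((l @ [b]) @ [a]) f origin = iter {} ((l @ [a]) @ [b]) f origin"
        if f: "f \<in> borel_measurable (powM J T)" for f
      proof -
        have "iter {} l (iter (set l) [a, b] f) origin = iter {} l (iter (set l) [b, a] f) origin"
        proof (rule iter_cong)
          fix z assume "z \<in> space (powM J ({} \<union> set l))"
          moreover have "insert a (insert b (set l)) = T" using l ab by auto
          ultimately show "iter (set l) [a, b] f z = iter (set l) [b, a] f z"
            using ab False l psubset.prems(1) f by (intro iter_swap) auto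
        qed (use l psubset.prems(1) origin_space in auto)
        then show ?thesis by (simp only: append_assoc iter_append append_Cons append_Nil Un_empty_left)
      qed
      show ?thesis
        unfolding agree_def
      proof (intro allI ballI impI)
        fix vs ws :: "'v list" and f :: "('v \<Rightarrow> 'a) \<Rightarrow> ennreal" assume f: "f \<in> borel_measurable (powM J T)"
          and vw: "distinct (vs @ [a])" "distinct (ws @ [b])" "set (vs @ [a]) = T" "set (ws @ [b]) = T"
        show "iter {} (vs @ [a]) f origin = iter {} (ws @ [b]) f origin"
          using agreeD[OF refl f vw(1) l'(1) vw(3) l'(2)] swap[OF f]
            agreeD[OF refl f l'(3) vw(2) l'(4) vw(4)] by simp
      qed
    qed
    have all: "agree a b" if ab: "a \<in> T" "b \<in> T" for a b
    proof (rule ccontr)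
      assume nab: "\<not> agree a b"
      define A where "A = {c \<in> T. agree a c}"
      define B where "B = T - A"
      have "a \<in> A" "b \<in> B" using ab nab refl by (auto simp: A_def B_def)
      have AB: "A \<union> B = T" "A \<inter> B = {}" by (auto simp: A_def B_def)
      have cross: "E a' b'" if "a' \<in> A" "b' \<in> B" for a' b'
        using that nonadjacent[of a' b'] trans[of a a' b'] by (auto simp: A_def B_def)
      have "\<exists>\<mu> \<nu>. markov_family J \<eta> E (A \<union> B) \<mu> \<nu>"
      proof (rule bipartite_family)
        fix x y assume "x \<in> A" "y \<in> A"
        then show "\<not> E x y" using cross[OF _ \<open>b \<in> B\<close>] no_triangle adj_sym by blast
      next
        fix x y assume "x \<in> B" "y \<in> B"
        then show "\<not> E x y" using cross[OF \<open>a \<in> A\<close>] no_triangle adj_sym by blast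
      qed (use \<open>a \<in> A\<close> \<open>b \<in> B\<close> AB cross psubset.prems(1) in auto)
      then obtain \<mu> \<nu> where fam: "markov_family J \<eta> E T \<mu> \<nu>" unfolding AB by blast
      have "agree a b"
        unfolding agree_def
      proof (intro allI ballI impI)
        fix vs ws :: "'v list" and f :: "('v \<Rightarrow> 'a) \<Rightarrow> ennreal" assume f: "f \<in> borel_measurable (powM J T)"
          and vw: "distinct (vs @ [a])" "distinct (ws @ [b])" "set (vs @ [a]) = T" "set (ws @ [b]) = T"
        show "iter {} (vs @ [a]) f origin = iter {} (ws @ [b]) f origin"
          using family_integral[OF fam psubset.prems(1) vw(1)] family_integral[OF fam psubset.prems(1) vw(2)] f
          unfolding vw(3,4) by simp
      qed
      then show False using nab by simp
    qed
    show ?case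
    proof (cases "T = {}")
      case True
      then show ?thesis using psubset.prems by simp
    next
      case False
      then obtain vs' a ws' b where vw: "vs = vs' @ [a]" "ws = ws' @ [b]"
        using psubset.prems(4,5) by (metis rev_exhaust set_empty)
      then have "a \<in> T" "b \<in> T" using psubset.prems by auto
      then show ?thesis
        using agreeD[OF all psubset.prems(6)] psubset.prems(2-5) unfolding vw by blast
    qed
  qed
qed

end

section \<open>The family of the whole graph\<close>

context complete_bipartite_measured
begin

definition enum :: "'v list" where
  "enum = (SOME l. distinct l \<and> set l = V)"

text \<open>All vertex sets are enumerated in the order of one fixed list, so that the enumerations of two
  disjoint sets interleave to the enumeration of their union.\<close>

definition seq :: "'v set \<Rightarrow> 'v list" where
  "seq T = filter (\<lambda>v. v \<in> T) enum"

lemma enum: "distinct enum" "set enum = V"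
proof -
  have "\<exists>l. distinct l \<and> set l = V" using finite_distinct_list[OF finite_V] by blast
  from someI_ex[OF this] show "distinct enum" "set enum = V" by (auto simp: enum_def)
qed

lemma distinct_seq: "distinct (seq T)"
  by (simp add: seq_def enum)

lemma set_seq: "T \<subseteq> V \<Longrightarrow> set (seq T) = T"
  by (auto simp: seq_def enum)

lemma set_seq_Diff: "T \<subseteq> V \<Longrightarrow> set (seq (T - S)) = T - S"
  by (rule set_seq) auto

text \<open>The law of a random placement of \<open>T\<close> that extends \<open>x\<close>.\<close>

definition joint :: "'v set \<Rightarrow> 'v set \<Rightarrow> ('v \<Rightarrow> 'a) \<Rightarrow> ('v \<Rightarrow> 'a) measure" where
  "joint S T x = (SOME M. sets M = sets (powM J T) \<and>
     (\<forall>f\<in>borel_measurable (powM J T). (\<integral>\<^sup>+ z. f z \<partial>M) = iter S (seq (T - S)) f x))"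

lemma
  assumes T: "T \<subseteq> V" "S \<subseteq> T" and x: "x \<in> space (powM J S)"
  shows sets_joint: "sets (joint S T x) = sets (powM J T)"
    and integral_joint: "f \<in> borel_measurable (powM J T) \<Longrightarrow>
      (\<integral>\<^sup>+ z. f z \<partial>joint S T x) = iter S (seq (T - S)) f x"
proof -
  have "T - S \<subseteq> V" "S \<union> (T - S) = T" "S \<subseteq> V" using T by auto
  then have "\<exists>M. sets M = sets (powM J T) \<and>
     (\<forall>f\<in>borel_measurable (powM J T). (\<integral>\<^sup>+ z. f z \<partial>M) = iter S (seq (T - S)) f x)"
    using iter_measure[of S "seq (T - S)" x] x by (simp add: set_seq)
  from someI_ex[OF this] show "sets (joint S T x) = sets (powM J T)"
    "f \<in> borel_measurable (powM J T) \<Longrightarrow> (\<integral>\<^sup>+ z. f z \<partial>joint S T x) = iter S (seq (T - S)) f x"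
    by (auto simp: joint_def)
qed

definition hom :: "'v set \<Rightarrow> ('v \<Rightarrow> 'a) measure" where
  "hom T = joint {} T origin"

definition cond :: "'v set \<Rightarrow> 'v set \<Rightarrow> ('v \<Rightarrow> 'a) \<Rightarrow> ('v \<Rightarrow> 'a) measure" where
  "cond S T x = distr (joint S T x) (powM J (T - S)) (\<lambda>z. restrict z (T - S))"

lemma sets_hom: "T \<subseteq> V \<Longrightarrow> sets (hom T) = sets (powM J T)"
  unfolding hom_def by (rule sets_joint) (auto simp: origin_space)

lemma space_hom: "T \<subseteq> V \<Longrightarrow> space (hom T) = space (powM J T)"
  by (rule sets_eq_imp_space_eq[OF sets_hom])

lemma integral_hom:
  assumes "distinct vs" "set vs = T" "T \<subseteq> V" "f \<in> borel_measurable (powM J T)"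
  shows "(\<integral>\<^sup>+ z. f z \<partial>hom T) = iter {} vs f origin"
proof -
  have "(\<integral>\<^sup>+ z. f z \<partial>hom T) = iter {} (seq T) f origin"
    unfolding hom_def using integral_joint[of T "{}" origin f] assms origin_space by simp
  then show ?thesis
    using order_independent[OF assms(3) distinct_seq assms(1) set_seq assms(2,4)] assms(3) by simp
qed

lemma emeasure_hom:
  assumes "distinct vs" "set vs = T" "T \<subseteq> V" "C \<in> sets (powM J T)"
  shows "emeasure (hom T) C = iter {} vs (indicator C) origin"
  using integral_hom[OF assms(1-3), of "indicator C"] assms(4) sets_hom[OF assms(3)] by simp

lemma hom_eqI:
  assumes "distinct vs" "set vs = T" "T \<subseteq> V" and M: "sets M = sets (powM J T)"
    and "\<And>C. C \<in> sets (powM J T) \<Longrightarrow> emeasure M C = iter {} vs (indicator C) origin"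
  shows "hom T = M"
  by (rule measure_eqI) (use assms sets_hom emeasure_hom in auto)

lemma sets_cond: "sets (cond S T x) = sets (powM J (T - S))"
  by (simp add: cond_def)

lemma integral_cond:
  assumes T: "T \<subseteq> V" "S \<subseteq> T" and x: "x \<in> space (powM J S)"
    and f: "f \<in> borel_measurable (powM J (T - S))"
  shows "(\<integral>\<^sup>+ y. f y \<partial>cond S T x) = iter S (seq (T - S)) (\<lambda>z. f (restrict z (T - S))) x"
proof -
  have r: "(\<lambda>z. restrict z (T - S)) \<in> measurable (powM J T) (powM J (T - S))"
    by (rule measurable_restrict_subset) auto
  have "(\<lambda>z. restrict z (T - S)) \<in> measurable (joint S T x) (powM J (T - S))"
    using r measurable_cong_sets[OF sets_joint[OF T x] refl] by blast
  then have "(\<integral>\<^sup>+ y. f y \<partial>cond S T x) = (\<integral>\<^sup>+ z. f (restrict z (T - S)) \<partial>joint S T x)"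
    unfolding cond_def by (rule nn_integral_distr) (use f in simp)
  also have "\<dots> = iter S (seq (T - S)) (\<lambda>z. f (restrict z (T - S))) x"
    by (rule integral_joint[OF T x measurable_compose[OF r f]])
  finally show ?thesis .
qed

lemma merge_restrict:
  assumes "S \<subseteq> T" "z \<in> space (powM J T)" "restrict z S = x"
  shows "merge S (T - S) (x, restrict z (T - S)) = z"
  unfolding assms(3)[symmetric] using assms(1,2)
  by (auto simp: merge_def space_PiM PiE_def extensional_def fun_eq_iff)

text \<open>Under \<open>iter S\<close> the coordinates in \<open>S\<close> keep their values \<open>x\<close>, so they can be put back after
  restricting to \<open>T - S\<close>.\<close>

lemma iter_merge:
  assumes T: "T \<subseteq> V" "S \<subseteq> T" and x: "x \<in> space (powM J S)"
  shows "iter S (seq (T - S)) (\<lambda>z. f (merge S (T - S) (x, restrict z (T - S)))) x =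
    iter S (seq (T - S)) f x"
proof (rule iter_cong)
  have s: "set (seq (T - S)) = T - S" "S \<union> (T - S) = T" using T by (auto simp: set_seq set_seq_Diff)
  fix z assume "z \<in> space (powM J (S \<union> set (seq (T - S))))" "restrict z S = x"
  then show "f (merge S (T - S) (x, restrict z (T - S))) = f z"
    unfolding s by (simp only: merge_restrict[OF T(2)])
qed (use T x in \<open>auto simp: distinct_seq set_seq_Diff\<close>)

lemma emeasure_cond_slice:
  assumes T: "T \<subseteq> V" "S \<subseteq> T" and x: "x \<in> space (powM J S)" and C: "C \<in> sets (powM J T)"
  shows "emeasure (cond S T x) (slice J S T C x) = iter S (seq (T - S)) (indicator C) x"
proof -
  have s: "set (seq (T - S)) = T - S" "S \<union> (T - S) = T" using T by (auto simp: set_seq set_seq_Diff)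
  have sl: "slice J S T C x \<in> sets (powM J (T - S))"
    by (rule slice_measurable[OF C T(2) x])
  have "emeasure (cond S T x) (slice J S T C x) = (\<integral>\<^sup>+ y. indicator (slice J S T C x) y \<partial>cond S T x)"
    using sl by (simp add: sets_cond)
  also have "\<dots> = iter S (seq (T - S)) (\<lambda>z. indicator (slice J S T C x) (restrict z (T - S))) x"
    using sl by (intro integral_cond[OF T x]) simp
  also have "\<dots> = iter S (seq (T - S)) (indicator C) x"
  proof (rule iter_cong)
    fix z assume z: "z \<in> space (powM J (S \<union> set (seq (T - S))))" "restrict z S = x"
    then have z': "z \<in> space (powM J T)" by (simp only: s)
    then have "restrict z (T - S) \<in> space (powM J (T - S))"
      by (auto simp: space_PiM)
    then have "restrict z (T - S) \<in> slice J S T C x \<longleftrightarrow> z \<in> C"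
      unfolding slice_def mem_Collect_eq merge_restrict[OF T(2) z' z(2)] by blast
    then show "indicator (slice J S T C x) (restrict z (T - S)) = (indicator C z :: ennreal)"
      by (simp only: indicator_def)
  qed (use T x in \<open>auto simp: distinct_seq s\<close>)
  finally show ?thesis .
qed

text \<open>By \<open>order_independent\<close>, the vertices of \<open>T\<close> can be placed beginning with those of \<open>S\<close>.\<close>

lemma hom_disintegration:
  assumes T: "T \<subseteq> V" "S \<subseteq> T"
  shows "disintegration J hom S T (cond S T)"
  unfolding disintegration_def
proof (intro conjI ballI)
  show "sets (cond S T x) = sets (powM J (T - S))" for x by (rule sets_cond)
  fix C assume C: "C \<in> sets (powM J T)"
  have S: "S \<subseteq> V" "set (seq (T - S)) = T - S" "set (seq S) = S" "S \<union> (T - S) = T"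
    using T by (auto simp: set_seq set_seq_Diff)
  have m: "iter S (seq (T - S)) (indicator C) \<in> borel_measurable (powM J S)"
    using C S T by (intro iter_measurable) auto
  show "(\<lambda>x. emeasure (cond S T x) (slice J S T C x)) \<in> borel_measurable (powM J S)"
    by (rule measurable_cong[THEN iffD2, OF _ m]) (simp add: emeasure_cond_slice[OF T _ C])
  have "emeasure (hom T) C = iter {} (seq S @ seq (T - S)) (indicator C) origin"
    using T C S by (intro emeasure_hom) (auto simp: distinct_seq)
  also have "\<dots> = iter {} (seq S) (iter S (seq (T - S)) (indicator C)) origin"
    by (simp only: iter_append S Un_empty_left)
  also have "\<dots> = (\<integral>\<^sup>+ x. iter S (seq (T - S)) (indicator C) x \<partial>hom S)"
    using S m by (intro integral_hom[symmetric]) (auto simp: distinct_seq)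
  also have "\<dots> = (\<integral>\<^sup>+ x. emeasure (cond S T x) (slice J S T C x) \<partial>hom S)"
    by (rule nn_integral_cong) (simp add: space_hom[OF S(1)] emeasure_cond_slice[OF T _ C])
  finally show "emeasure (hom T) C = (\<integral>\<^sup>+ x. emeasure (cond S T x) (slice J S T C x) \<partial>hom S)" .
qed

text \<open>The set of all \<open>z\<close> that restrict to the null set \<open>A\<close> has empty slices outside of \<open>A\<close>.\<close>

lemma hom_marginals:
  assumes T: "T \<subseteq> V" "S \<subseteq> T"
  shows "absolutely_continuous (hom S) (distr (hom T) (powM J S) (\<lambda>x. restrict x S))"
  unfolding absolutely_continuous_def
proof
  fix A assume A: "A \<in> null_sets (hom S)"
  have S: "S \<subseteq> V" using T by auto
  have r: "(\<lambda>z. restrict z S) \<in> measurable (powM J T) (powM J S)"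
    using T by (intro measurable_restrict_subset)
  have r': "(\<lambda>z. restrict z S) \<in> measurable (hom T) (powM J S)"
    using r measurable_cong_sets[OF sets_hom[OF T(1)] refl] by blast
  have A': "A \<in> sets (powM J S)" using A sets_hom[OF S] by auto
  let ?C = "(\<lambda>z. restrict z S) -` A \<inter> space (powM J T)"
  have C: "?C \<in> sets (powM J T)" by (rule measurable_sets[OF r A'])
  have sl: "slice J S T ?C x = {}" if x: "x \<in> space (powM J S)" "x \<notin> A" for x
  proof -
    have "restrict (merge S (T - S) (x, y)) S = x" for y
      using x by (auto simp: space_PiM PiE_def extensional_def merge_def fun_eq_iff)
    then show ?thesis using x by (simp add: slice_def)
  qed
  have "emeasure (distr (hom T) (powM J S) (\<lambda>x. restrict x S)) A = emeasure (hom T) ?C"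
    using A' r' by (simp add: emeasure_distr space_hom[OF T(1)])
  also have "\<dots> = (\<integral>\<^sup>+ x. emeasure (cond S T x) (slice J S T ?C x) \<partial>hom S)"
    using hom_disintegration[OF T] C by (simp add: disintegration_def)
  also have "\<dots> = (\<integral>\<^sup>+ x. 0 \<partial>hom S)"
  proof (rule nn_integral_cong_AE)
    show "AE x in hom S. emeasure (cond S T x) (slice J S T ?C x) = 0"
      using AE_not_in[OF A] AE_space by eventually_elim (simp add: sl space_hom[OF S])
  qed
  finally show "A \<in> null_sets (distr (hom T) (powM J S) (\<lambda>x. restrict x S))"
    using A' by (intro null_setsI) auto
qed

lemma sigma_finite_hom:
  assumes T: "T \<subseteq> V"
  shows "sigma_finite_measure (hom T)"
proof -
  obtain h where h: "h \<in> borel_measurable (powM J T)" "\<And>z. z \<in> space (powM J T) \<Longrightarrow> h z > 0"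
    "iter {} (seq T) h origin \<le> 1"
    using iter_bounded_weight[of "{}" "seq T"] T origin_space by (auto simp: set_seq distinct_seq)
  show ?thesis
  proof (rule sigma_finite_by_weight)
    show "h \<in> borel_measurable (hom T)"
      using h(1) measurable_cong_sets[OF sets_hom[OF T] refl] by blast
    show "h x > 0" if "x \<in> space (hom T)" for x using h(2) that by (simp add: space_hom[OF T])
    show "(\<integral>\<^sup>+ x. h x \<partial>hom T) < top"
      using integral_hom[OF distinct_seq set_seq T h(1)] T h(3) by (auto intro: le_less_trans)
  qed
qed

text \<open>Sigma-finiteness does not pass to images in general, but here the discarded coordinates are
  constant, and the weight function can be transported along \<open>merge\<close>.\<close>

lemma sigma_finite_cond:
  assumes T: "T \<subseteq> V" "S \<subseteq> T" and x: "x \<in> space (powM J S)"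
  shows "sigma_finite_measure (cond S T x)"
proof -
  have s: "set (seq (T - S)) = T - S" "S \<union> (T - S) = T" "S \<subseteq> V" "T - S \<subseteq> V"
    using T by (auto simp: set_seq set_seq_Diff)
  have disj: "(T - S) \<inter> S = {}" by auto
  obtain h where h: "h \<in> borel_measurable (powM J T)" "\<And>z. z \<in> space (powM J T) \<Longrightarrow> h z > 0"
    "iter S (seq (T - S)) h x \<le> 1"
    using iter_bounded_weight[of S "seq (T - S)", unfolded s, OF s(3,4) distinct_seq disj] x by blast
  define g where "g y = h (merge S (T - S) (x, y))" for y
  have mg: "(\<lambda>y. merge S (T - S) (x, y)) \<in> measurable (powM J (T - S)) (powM J T)"
    by (rule measurable_Pair2[OF measurable_merge[of S "T - S" "\<lambda>_. J", unfolded s] x])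
  have g: "g \<in> borel_measurable (powM J (T - S))"
    unfolding g_def by (rule measurable_compose[OF mg h(1)])
  have sp: "space (cond S T x) = space (powM J (T - S))"
    by (rule sets_eq_imp_space_eq[OF sets_cond])
  show ?thesis
  proof (rule sigma_finite_by_weight)
    show "g \<in> borel_measurable (cond S T x)"
      using g measurable_cong_sets[OF sets_cond refl] by blast
    show "g y > 0" if "y \<in> space (cond S T x)" for y
      using h(2) measurable_space[OF mg] that by (simp add: sp g_def)
    have "(\<integral>\<^sup>+ y. g y \<partial>cond S T x) = iter S (seq (T - S)) h x"
      using integral_cond[OF T x g] iter_merge[OF T x] by (simp add: g_def)
    then show "(\<integral>\<^sup>+ y. g y \<partial>cond S T x) < top"
      using h(3) by (auto intro: le_less_trans)
  qed
qed

text \<open>Both sides are computed by placing the vertices of \<open>U - S\<close> before those of \<open>W - S\<close>; the equality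
  holds at every \<open>x\<close>.\<close>

lemma cond_product:
  assumes UW: "U \<subseteq> V" "W \<subseteq> V" "S = U \<inter> W" and x: "x \<in> space (powM J S)"
    and nE: "\<And>u w. u \<in> U - S \<Longrightarrow> w \<in> W - S \<Longrightarrow> \<not> E u w"
  shows "cond S (U \<union> W) x = prodM J (U - S) (W - S) (cond S U x) (cond S W x)"
proof (rule measure_eqI)
  let ?P = "U - S" and ?Q = "W - S"
  have sub: "S \<subseteq> V" "S \<subseteq> U" "S \<subseteq> W" "U \<union> W \<subseteq> V" "S \<subseteq> U \<union> W" "U \<union> W - S = ?P \<union> ?Q"
    "?P \<inter> ?Q = {}" "?P \<union> ?Q \<subseteq> V" "S \<union> (?P \<union> ?Q) = U \<union> W"
    using UW by auto
  show "sets (cond S (U \<union> W) x) = sets (prodM J ?P ?Q (cond S U x) (cond S W x))"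
    unfolding sets_cond sub by (simp add: prodM_def)
  fix C assume "C \<in> sets (cond S (U \<union> W) x)"
  then have C: "C \<in> sets (powM J (?P \<union> ?Q))" by (simp add: sets_cond sub)
  interpret W: sigma_finite_measure "cond S W x"
    by (rule sigma_finite_cond[OF UW(2) sub(3) x])
  have mg: "merge ?P ?Q \<in> measurable (powM J ?P \<Otimes>\<^sub>M powM J ?Q) (powM J (?P \<union> ?Q))"
    by (rule measurable_merge)
  have ms: "measurable (cond S U x \<Otimes>\<^sub>M cond S W x) N = measurable (powM J ?P \<Otimes>\<^sub>M powM J ?Q) N" for N :: "'c measure"
    by (intro measurable_cong_sets sets_pair_measure_cong sets_cond refl)
  have ind: "(\<lambda>pq. indicator C (merge ?P ?Q pq) :: ennreal) \<in> borel_measurable (powM J ?P \<Otimes>\<^sub>M powM J ?Q)"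
    using C by (intro measurable_compose[OF mg]) simp
  have inner: "(\<integral>\<^sup>+ q. indicator C (merge ?P ?Q (p, q)) \<partial>cond S W x) =
      iter S (seq ?Q) (\<lambda>z. indicator C (merge ?P ?Q (p, restrict z ?Q))) x"
    if "p \<in> space (powM J ?P)" for p
    by (rule integral_cond[OF UW(2) sub(3) x measurable_Pair2[OF ind that]])
  have "emeasure (prodM J ?P ?Q (cond S U x) (cond S W x)) C =
      (\<integral>\<^sup>+ pq. indicator C pq \<partial>prodM J ?P ?Q (cond S U x) (cond S W x))"
    using C by (simp add: prodM_def)
  also have "\<dots> = (\<integral>\<^sup>+ pq. indicator C (merge ?P ?Q pq) \<partial>(cond S U x \<Otimes>\<^sub>M cond S W x))"
    unfolding prodM_def using mg C by (intro nn_integral_distr) (simp_all add: ms)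
  also have "\<dots> = (\<integral>\<^sup>+ p. \<integral>\<^sup>+ q. indicator C (merge ?P ?Q (p, q)) \<partial>cond S W x \<partial>cond S U x)"
    using ind by (intro W.nn_integral_fst[symmetric]) (simp add: ms)
  also have "\<dots> = iter S (seq ?P) (\<lambda>y. \<integral>\<^sup>+ q. indicator C (merge ?P ?Q (restrict y ?P, q)) \<partial>cond S W x) x"
  proof (rule integral_cond[OF UW(1) sub(2) x])
    have "(\<lambda>pq. indicator C (merge ?P ?Q pq) :: ennreal) \<in> borel_measurable (powM J ?P \<Otimes>\<^sub>M cond S W x)"
      using ind measurable_cong_sets[OF sets_pair_measure_cong[OF refl sets_cond] refl] by blast
    then show "(\<lambda>p. \<integral>\<^sup>+ q. indicator C (merge ?P ?Q (p, q)) \<partial>cond S W x) \<in> borel_measurable (powM J ?P)"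
      by (rule W.borel_measurable_nn_integral_fst)
  qed
  also have "\<dots> = iter S (seq ?P) (\<lambda>y. iter S (seq ?Q)
      (\<lambda>z. indicator C (merge ?P ?Q (restrict y ?P, restrict z ?Q))) x) x"
  proof (rule iter_cong)
    fix y assume "y \<in> space (powM J (S \<union> set (seq ?P)))"
    then have "restrict y ?P \<in> space (powM J ?P)"
      using UW by (auto simp: space_PiM set_seq_Diff)
    then show "(\<integral>\<^sup>+ q. indicator C (merge ?P ?Q (restrict y ?P, q)) \<partial>cond S W x) =
        iter S (seq ?Q) (\<lambda>z. indicator C (merge ?P ?Q (restrict y ?P, restrict z ?Q))) x"
      by (rule inner)
  qed (use UW x in \<open>auto simp: distinct_seq set_seq_Diff\<close>)
  also have "\<dots> = iter S (seq ?P) (\<lambda>y. iter S (seq ?Q)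
      (\<lambda>z. indicator C (restrict (override_on z y ?P) (?P \<union> ?Q))) x) x"
  proof -
    have "merge ?P ?Q (restrict y ?P, restrict z ?Q) = restrict (override_on z y ?P) (?P \<union> ?Q)" for y z :: "'v \<Rightarrow> 'a"
      by (auto simp: fun_eq_iff merge_def override_on_def)
    then show ?thesis by (simp only:)
  qed
  also have "\<dots> = iter S (seq (?P \<union> ?Q)) (\<lambda>z. indicator C (restrict z (?P \<union> ?Q))) x"
  proof -
    have f: "filter (\<lambda>v. v \<in> ?P) (seq (?P \<union> ?Q)) = seq ?P" "filter (\<lambda>v. v \<in> ?Q) (seq (?P \<union> ?Q)) = seq ?Q"
      by (auto simp: seq_def intro!: filter_cong)
    have "(\<lambda>z. restrict z (?P \<union> ?Q)) \<in> measurable (powM J (U \<union> W)) (powM J (?P \<union> ?Q))"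
      by (rule measurable_restrict_subset) auto
    then have "(\<lambda>z. indicator C (restrict z (?P \<union> ?Q)) :: ennreal) \<in> borel_measurable (powM J (U \<union> W))"
      by (rule measurable_compose) (use C in simp)
    then have "iter S (seq (?P \<union> ?Q)) (\<lambda>z. indicator C (restrict z (?P \<union> ?Q))) x =
        iter S (filter (\<lambda>v. v \<in> ?P) (seq (?P \<union> ?Q)))
          (\<lambda>y. iter S (filter (\<lambda>v. v \<in> ?Q) (seq (?P \<union> ?Q)))
            (\<lambda>z. indicator C (restrict (override_on z y ?P) (?P \<union> ?Q))) x) x"
      using sub(1,7,8) x
    proof (intro iter_product)
      show "\<not> E q p" if "p \<in> ?P" "q \<in> ?Q" for p q using nE that adj_sym by blast
    qed (auto simp: set_seq[OF sub(8)] distinct_seq sub(9))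
    then show ?thesis unfolding f by (rule sym)
  qed
  also have "\<dots> = (\<integral>\<^sup>+ z. indicator C z \<partial>cond S (U \<union> W) x)"
    using integral_cond[OF sub(4,5) x, of "indicator C"] C by (simp only: sub borel_measurable_indicator)
  also have "\<dots> = emeasure (cond S (U \<union> W) x) C"
    using C by (simp add: sets_cond sub)
  finally show "emeasure (cond S (U \<union> W) x) C = emeasure (prodM J ?P ?Q (cond S U x) (cond S W x)) C"
    by (rule sym)
qed

lemma hom_vertex:
  assumes i: "i \<in> V"
  shows "hom {i} = distr (marginal J \<eta>) (powM J {i}) (\<lambda>a. \<lambda>k\<in>{i}. a)"
proof (rule hom_eqI[where vs = "[i]"])
  fix C assume C: "C \<in> sets (powM J {i})"
  have vm: "(\<lambda>a. \<lambda>k\<in>{i}. a) \<in> measurable (marginal J \<eta>) (powM J {i})"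
    by (subst measurable_cong_sets[OF sets_marginal refl]) (rule vertex_map)
  have "(\<lambda>k\<in>{i}. a) = origin(i := a)" for a by auto
  then have eq: "(\<integral>\<^sup>+ a. indicator C (\<lambda>k\<in>{i}. a) \<partial>marginal J \<eta>) = iter {} [i] (indicator C) origin"
    by (simp add: step_def nbrs_def canonical_kernel_def)
  have "emeasure (distr (marginal J \<eta>) (powM J {i}) (\<lambda>a. \<lambda>k\<in>{i}. a)) C =
      (\<integral>\<^sup>+ z. indicator C z \<partial>distr (marginal J \<eta>) (powM J {i}) (\<lambda>a. \<lambda>k\<in>{i}. a))"
    using C by simp
  also have "\<dots> = (\<integral>\<^sup>+ a. indicator C (\<lambda>k\<in>{i}. a) \<partial>marginal J \<eta>)"
    using C vm by (intro nn_integral_distr) simp_all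
  finally show "emeasure (distr (marginal J \<eta>) (powM J {i}) (\<lambda>a. \<lambda>k\<in>{i}. a)) C =
      iter {} [i] (indicator C) origin" unfolding eq .
qed (use i in auto)

text \<open>A single edge is the complete bipartite graph \<open>K\<^sub>1\<^sub>,\<^sub>1\<close>, and its family is normalized.\<close>

lemma hom_edge:
  assumes ij: "i \<in> V" "j \<in> V" "E i j"
  shows "hom {i, j} = distr \<eta> (powM J {i, j}) (\<lambda>(a, b). \<lambda>k\<in>{i, j}. if k = i then a else b)"
proof -
  have ne: "i \<noteq> j" using ij adj_irrefl by auto
  have "\<exists>\<mu> \<nu>. markov_family J \<eta> E ({i} \<union> {j}) \<mu> \<nu>"
    using ij ne adj_irrefl by (intro bipartite_family) auto
  then obtain \<mu> \<nu> where fam: "markov_family J \<eta> E {i, j} \<mu> \<nu>"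
    by (auto simp: insert_commute)
  interpret markov_family J \<eta> E "{i, j}" \<mu> \<nu> by fact
  have "hom {i, j} = \<mu> {i, j}"
  proof (rule hom_eqI[where vs = "[i, j]"])
    show "sets (\<mu> {i, j}) = sets (powM J {i, j})" by (rule sets_mu) simp
    fix C assume C: "C \<in> sets (powM J {i, j})"
    have "emeasure (\<mu> {i, j}) C = (\<integral>\<^sup>+ z. indicator C z \<partial>\<mu> {i, j})"
      using C sets_mu[of "{i, j}"] by simp
    also have "\<dots> = iter {} [i, j] (indicator C) origin"
      using family_integral[OF fam _ _ _, of "[i, j]" "indicator C"] ij ne C by simp
    finally show "emeasure (\<mu> {i, j}) C = iter {} [i, j] (indicator C) origin" .
  qed (use ij ne in auto)
  then show ?thesis using edge ij(3) by simp
qed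

lemma markov_family_hom: "markov_family J \<eta> E V hom cond"
proof (rule markov_family.intro)
  show "hom {} = return (powM J {}) origin"
    by (rule hom_eqI[where vs = "[]"]) simp_all
  fix U W S assume UW: "U \<subseteq> V" "W \<subseteq> V" "S = U \<inter> W"
    and nE: "\<And>u w. u \<in> U - S \<Longrightarrow> w \<in> W - S \<Longrightarrow> \<not> E u w"
  have S: "S \<subseteq> V" using UW by auto
  show "AE x in hom S. cond S (U \<union> W) x = prodM J (U - S) (W - S) (cond S U x) (cond S W x)"
    by (intro AE_I2 cond_product[OF UW _ nE]) (simp only: space_hom[OF S])
qed (fact sets_hom sigma_finite_hom hom_vertex hom_edge hom_marginals hom_disintegration)+

end

section \<open>From graphs to adjacency relations\<close>

lemma markov_family_of_well_measured:
  assumes "well_measured J \<eta> H"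
  obtains \<mu> \<nu> where "markov_family J \<eta> (\<lambda>u v. u \<rightarrow>\<^bsub>H\<^esub> v) (verts H) \<mu> \<nu>"
proof -
  from assms obtain \<mu> where mf: "measure_family J (verts H) \<mu>" and n: "normalized J \<eta> H \<mu>"
    and d: "decreasing J (verts H) \<mu>" and m: "markovian J H \<mu>"
    unfolding well_measured_def by blast
  obtain \<nu> where dis: "\<forall>T\<subseteq>verts H. \<forall>S\<subseteq>T. disintegration J \<mu> S T (\<nu> S T)"
    and mk: "\<forall>U\<subseteq>verts H. \<forall>W\<subseteq>verts H. \<forall>S. S = U \<inter> W \<longrightarrow>
             (\<forall>u\<in>U - S. \<forall>w\<in>W - S. \<not> u \<rightarrow>\<^bsub>H\<^esub> w) \<longrightarrow>
             (AE x in \<mu> S. \<nu> S (U \<union> W) x = prodM J (U - S) (W - S) (\<nu> S U x) (\<nu> S W x))"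
    using m unfolding markovian_def by (elim conjE exE) (rule that)
  have "markov_family J \<eta> (\<lambda>u v. u \<rightarrow>\<^bsub>H\<^esub> v) (verts H) \<mu> \<nu>"
  proof (rule markov_family.intro)
    fix S assume "S \<subseteq> verts H"
    then show "sets (\<mu> S) = sets (powM J S)" "sigma_finite_measure (\<mu> S)"
      using mf unfolding measure_family_def by blast+
  next
    fix i assume "i \<in> verts H"
    then show "\<mu> {i} = distr (marginal J \<eta>) (powM J {i}) (\<lambda>a. \<lambda>k\<in>{i}. a)"
      using n unfolding normalized_def by blast
  next
    fix i j assume "i \<rightarrow>\<^bsub>H\<^esub> j"
    then show "\<mu> {i, j} = distr \<eta> (powM J {i, j}) (\<lambda>(a, b). \<lambda>k\<in>{i, j}. if k = i then a else b)"
      using n unfolding normalized_def by blast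
  next
    show "\<mu> {} = return (powM J {}) (\<lambda>_. undefined)"
      using n unfolding normalized_def by blast
  next
    fix S T assume "T \<subseteq> verts H" "S \<subseteq> T"
    then show "absolutely_continuous (\<mu> S) (distr (\<mu> T) (powM J S) (\<lambda>x. restrict x S))"
      "disintegration J \<mu> S T (\<nu> S T)"
      using d dis unfolding decreasing_def by blast+
  next
    fix U W S assume "U \<subseteq> verts H" "W \<subseteq> verts H" "S = U \<inter> W"
      "\<And>u w. u \<in> U - S \<Longrightarrow> w \<in> W - S \<Longrightarrow> \<not> u \<rightarrow>\<^bsub>H\<^esub> w"
    then show "AE x in \<mu> S. \<nu> S (U \<union> W) x = prodM J (U - S) (W - S) (\<nu> S U x) (\<nu> S W x)"
      by (intro mk[rule_format]) auto
  qed
  then show thesis by (rule that)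
qed

lemma well_measured_of_markov_family:
  assumes H: "wf_digraph H" and fam: "markov_family J \<eta> (\<lambda>u v. u \<rightarrow>\<^bsub>H\<^esub> v) (verts H) \<mu> \<nu>"
  shows "well_measured J \<eta> H"
proof -
  interpret wf_digraph H by fact
  interpret markov_family J \<eta> "\<lambda>u v. u \<rightarrow>\<^bsub>H\<^esub> v" "verts H" \<mu> \<nu> by fact
  have mf: "measure_family J (verts H) \<mu>"
    using sets_mu sigma_finite by (simp add: measure_family_def)
  have d: "decreasing J (verts H) \<mu>"
    using marginals by (simp add: decreasing_def)
  have n: "normalized J \<eta> H \<mu>"
    unfolding normalized_def
  proof (intro conjI ballI allI impI)
    fix i j assume "i \<rightarrow>\<^bsub>H\<^esub> j"
    then show "\<mu> {i, j} = distr \<eta> (powM J {i, j}) (\<lambda>(a, b). \<lambda>k\<in>{i, j}. if k = i then a else b)"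
      by (intro edge) (auto dest: adj_in_verts)
  qed (fact vertex empty)+
  have m: "markovian J H \<mu>"
    unfolding markovian_def
  proof (intro conjI exI[of _ \<nu>] allI impI)
    fix U W S assume "U \<subseteq> verts H" "W \<subseteq> verts H" "S = U \<inter> W"
      "\<forall>u\<in>U - S. \<forall>w\<in>W - S. \<not> u \<rightarrow>\<^bsub>H\<^esub> w"
    then show "AE x in \<mu> S. \<nu> S (U \<union> W) x = prodM J (U - S) (W - S) (\<nu> S U x) (\<nu> S W x)"
      by (intro markov) auto
  qed (fact d disint)+
  show ?thesis using mf n d m unfolding well_measured_def by blast
qed

lemma markov_family_cong:
  assumes "\<And>u v. u \<in> X \<Longrightarrow> v \<in> X \<Longrightarrow> E u v \<longleftrightarrow> E' u v" and "markov_family J \<eta> E X \<mu> \<nu>"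
  shows "markov_family J \<eta> E' X \<mu> \<nu>"
proof -
  interpret markov_family J \<eta> E X \<mu> \<nu> by fact
  show ?thesis
  proof (rule markov_family.intro)
    fix i j assume "i \<in> X" "j \<in> X" "E' i j"
    then show "\<mu> {i, j} = distr \<eta> (powM J {i, j}) (\<lambda>(a, b). \<lambda>k\<in>{i, j}. if k = i then a else b)"
      using assms(1) by (intro edge) auto
  next
    fix U W S assume UW: "U \<subseteq> X" "W \<subseteq> X" "S = U \<inter> W"
      and "\<And>u w. u \<in> U - S \<Longrightarrow> w \<in> W - S \<Longrightarrow> \<not> E' u w"
    then have "\<not> E u w" if "u \<in> U - S" "w \<in> W - S" for u w
      using that assms(1) by blast
    then show "AE x in \<mu> S. \<nu> S (U \<union> W) x = prodM J (U - S) (W - S) (\<nu> S U x) (\<nu> S W x)"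
      by (intro markov UW)
  qed (fact sets_mu sigma_finite vertex empty marginals disint)+
qed

lemma graph_induce_subgraph:
  assumes "graph G" "S \<subseteq> verts G"
  shows "graph (G \<restriction> S)"
proof -
  interpret graph G by fact
  have ind: "induced_subgraph (G \<restriction> S) G" by (rule induced_induce[OF assms(2)])
  interpret H: wf_digraph "G \<restriction> S" by (rule wellformed_induce_subgraph)
  have "finite S" by (rule finite_subset[OF assms(2) finite_verts])
  then have fin: "fin_digraph (G \<restriction> S)"
    by (intro H.fin_digraphI) simp_all
  have loopfree: "loopfree_digraph (G \<restriction> S)"
    by unfold_locales (simp add: no_loops)
  have nomulti: "nomulti_digraph (G \<restriction> S)"
  proof
    fix e1 e2 assume "e1 \<in> arcs (G \<restriction> S)" "e2 \<in> arcs (G \<restriction> S)"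
      and eq: "arc_to_ends (G \<restriction> S) e1 = arc_to_ends (G \<restriction> S) e2"
    then have "e1 \<in> arcs G" "e2 \<in> arcs G" by simp_all
    then show "e1 = e2" by (rule no_multi_arcs) (use eq in simp)
  qed
  have sym: "sym_digraph (G \<restriction> S)"
    by unfold_locales (rule induced_graph_imp_symmetric[OF sym_arcs ind])
  show ?thesis
    by (intro graph.intro digraph.intro pseudo_graph.intro fin loopfree nomulti sym)
qed

lemma dominates_induce_subgraph:
  "u \<rightarrow>\<^bsub>G \<restriction> S\<^esub> v \<longleftrightarrow> u \<in> S \<and> v \<in> S \<and> u \<rightarrow>\<^bsub>G\<^esub> v"
proof
  assume "u \<rightarrow>\<^bsub>G \<restriction> S\<^esub> v"
  then obtain e where "e \<in> arcs (G \<restriction> S)" "(u, v) = arc_to_ends G e"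
    unfolding arcs_ends_def induce_subgraph_ends by (rule imageE)
  then show "u \<in> S \<and> v \<in> S \<and> u \<rightarrow>\<^bsub>G\<^esub> v"
    by (simp add: arcs_ends_def arc_to_ends_def image_iff) metis
next
  assume uv: "u \<in> S \<and> v \<in> S \<and> u \<rightarrow>\<^bsub>G\<^esub> v"
  then obtain e where e: "(u, v) = arc_to_ends G e" "e \<in> arcs G"
    unfolding arcs_ends_def by blast
  then have "e \<in> arcs (G \<restriction> S)" using uv by (simp add: arc_to_ends_def)
  then show "u \<rightarrow>\<^bsub>G \<restriction> S\<^esub> v"
    unfolding arcs_ends_def induce_subgraph_ends e(1) by (rule imageI)
qed

theorem theorem1p2:
  fixes G :: "('v, 'e) pre_digraph" and J :: "'a measure" and \<eta> :: "('a \<times> 'a) measure"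
  assumes "graph G" and "triangle_free G" and "markov_space J \<eta>"
    and "\<And>H a b. subgraph H G \<Longrightarrow> a \<ge> 1 \<Longrightarrow> b \<ge> 1 \<Longrightarrow> K\<^bsub>a,b\<^esub> H \<Longrightarrow> well_measured J \<eta> H"
  shows "well_measured J \<eta> G"
proof -
  interpret graph G by fact
  let ?E = "\<lambda>u v. u \<rightarrow>\<^bsub>G\<^esub> v"
  interpret edge_measure J \<eta>
    by (rule edge_measure.intro) (use assms(3) in \<open>simp_all add: markov_space_def\<close>)
  interpret complete_bipartite_measured J \<eta> ?E "verts G"
  proof (intro complete_bipartite_measured.intro edge_measure_axioms
      complete_bipartite_measured_axioms.intro)
    show "finite (verts G)" by simp
    show "v \<rightarrow>\<^bsub>G\<^esub> u" if "u \<rightarrow>\<^bsub>G\<^esub> v" for u v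
      by (rule graph_symmetric[OF that])
    show "\<not> v \<rightarrow>\<^bsub>G\<^esub> v" for v
      using adj_not_same by blast
    show False if "u \<rightarrow>\<^bsub>G\<^esub> v" "v \<rightarrow>\<^bsub>G\<^esub> w" "w \<rightarrow>\<^bsub>G\<^esub> u" for u v w
      using assms(2) that unfolding triangle_free_def by blast
  next
    fix A B assume ne: "A \<noteq> {}" "B \<noteq> {}" "A \<inter> B = {}" and AB: "A \<union> B \<subseteq> verts G"
      and cross: "\<And>a b. a \<in> A \<Longrightarrow> b \<in> B \<Longrightarrow> a \<rightarrow>\<^bsub>G\<^esub> b"
      and A: "\<And>a a'. a \<in> A \<Longrightarrow> a' \<in> A \<Longrightarrow> \<not> a \<rightarrow>\<^bsub>G\<^esub> a'"
      and B: "\<And>b b'. b \<in> B \<Longrightarrow> b' \<in> B \<Longrightarrow> \<not> b \<rightarrow>\<^bsub>G\<^esub> b'"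
    let ?H = "G \<restriction> (A \<union> B)"
    have fin: "finite A" "finite B" using AB finite_subset[OF AB] by auto
    have gH: "graph ?H" by (rule graph_induce_subgraph[OF assms(1) AB])
    have "u \<rightarrow>\<^bsub>?H\<^esub> v \<longleftrightarrow> (u, v) \<in> A \<times> B \<union> B \<times> A" for u v
      unfolding dominates_induce_subgraph
      using A[of u v] B[of u v] cross[of u v] cross[of v u] graph_symmetric[of v u] by blast
    then have "arcs_ends ?H = A \<times> B \<union> B \<times> A"
      by (intro set_eqI) (metis surj_pair)
    then have K: "K\<^bsub>card A,card B\<^esub> ?H"
      unfolding complete_bipartite_digraph_def induce_subgraph_verts using gH ne(3) by blast
    have sub: "subgraph ?H G"
      using induced_induce[OF AB] unfolding induced_subgraph_def by (rule conjunct1)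
    have "card A \<ge> 1" "card B \<ge> 1"
      using ne fin by (simp_all add: Suc_le_eq card_gt_0_iff)
    then have "well_measured J \<eta> ?H" by (rule assms(4)[OF sub _ _ K])
    then obtain \<mu> \<nu> where "markov_family J \<eta> (\<lambda>u v. u \<rightarrow>\<^bsub>?H\<^esub> v) (verts ?H) \<mu> \<nu>"
      by (rule markov_family_of_well_measured)
    then have "markov_family J \<eta> ?E (A \<union> B) \<mu> \<nu>"
      unfolding induce_subgraph_verts
      by (rule markov_family_cong[rotated]) (simp add: dominates_induce_subgraph)
    then show "\<exists>\<mu> \<nu>. markov_family J \<eta> ?E (A \<union> B) \<mu> \<nu>" by blast
  qed
  show ?thesis
    by (rule well_measured_of_markov_family[OF wf_digraph markov_family_hom])
qed

end
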